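(* Let $w$ be a bounded weight structure on a triangulated category $\mathcal C$ with heart $Hw$. Let $\mathcal C'$ be the idempotent completion of $\mathcal C$ and $Hw'$ the idempotent completion of $Hw$. Then: 1. $w$ extends to a bounded weight structure $w'$ for $\mathcal C'$. 2. $Hw'$ generates $\mathcal C'$. 3. The heart of $w'$ is equivalent to $Hw'$.
   Context: $D\perp E$ means $\mathcal C(X,Y)=0$ for all $X\in D$, $Y\in E$. A weight structure $w$ on a triangulated category $\mathcal C$ is a pair of subclasses $\mathcal C^{w\le 0},\mathcal C^{w\ge 0}\subset\mathrm{Obj}\,\mathcal C$ such that: (i) both are additive and Karoubi-closed in $\mathcal C$ (contain all retracts of their objects); (ii) $\mathcal C^{w\ge 0}\subset \mathcal C^{w\ge 0}[1]$ and $\mathcal C^{w\le 0}[1]\subset \mathcal C^{w\le 0}$; (iii) $\mathcal C^{w\ge 0}\perp\mathcal C^{w\le 0}[1]$; (iv) for every $X$ there is a distinguished triangle $B[-1]\to X\to A\to B$ with $A\in\mathcal C^{w\le 0}$, $B\in\mathcal C^{w\ge 0}$. The heart $Hw$ is the full subcategory on $\mathcal C^{w\ge0}\cap\mathcal C^{w\le0}$. $w$ is bounded if $\bigcup_l\mathcal C^{w\le0}[-l]=\bigcup_l\mathcal C^{w\ge0}[-l]=\mathrm{Obj}\,\mathcal C$. The idempotent completion of an additive category $A$ has objects $(X,p)$ with $p\in A(X,X)$, $p^2=p$, and morphisms $(X,p)\to(X',p')$ given by $\{f\in A(X,X'):p'f=fp=f\}$. By a theorem of Balmer and Schlichting the idempotent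 completion of a triangulated category is naturally triangulated (distinguished triangles being the direct summands of distinguished triangles of $\mathcal C$). $Hw'$ is regarded as a full subcategory of $\mathcal C'$. A subcategory generates $\mathcal C'$ if the smallest strictly full triangulated subcategory containing it is $\mathcal C'$. *)

theory Defs
  imports Main
begin

text \<open>
  Hom-sets are indexed by pairs of objects and need not be disjoint; they are additive
  subgroups of one ambient abelian group given by the type of morphisms, and composition
  and the action of the shift on morphisms are operations on that type which are only
  constrained on the hom-sets. No generality is lost: for an arbitrary small preadditive
  category take as ambient group the direct sum of all hom-groups. Nothing is assumed about
  objects outside \<open>Obj\<close>.
\<close>

section \<open>Additive categories\<close>

record ('o, 'm) category =
  Obj   :: "'o set"
  Hom   :: "'o \<Rightarrow> 'o \<Rightarrow> 'm set"
  ident :: "'o \<Rightarrow> 'm"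
  Comp  :: "'m \<Rightarrow> 'm \<Rightarrow> 'm"  (infixl "\<cdot>\<index>" 70)

text \<open>\<open>g \<cdot> f\<close> is \<open>g\<close> after \<open>f\<close>.\<close>

definition is_zero :: "('o, 'm::ab_group_add, 'z) category_scheme \<Rightarrow> 'o \<Rightarrow> bool" where
  "is_zero C Z \<longleftrightarrow> Z \<in> Obj C \<and> (\<forall>X\<in>Obj C. Hom C Z X = {0} \<and> Hom C X Z = {0})"

definition is_biproduct ::
  "('o, 'm::ab_group_add, 'z) category_scheme \<Rightarrow> 'o \<Rightarrow> 'o \<Rightarrow> 'o \<Rightarrow> 'm \<Rightarrow> 'm \<Rightarrow> 'm \<Rightarrow> 'm \<Rightarrow> bool" where
  "is_biproduct C X Y Z i j p q \<longleftrightarrow>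
     X \<in> Obj C \<and> Y \<in> Obj C \<and> Z \<in> Obj C \<and>
     i \<in> Hom C X Z \<and> j \<in> Hom C Y Z \<and> p \<in> Hom C Z X \<and> q \<in> Hom C Z Y \<and>
     p \<cdot>\<^bsub>C\<^esub> i = ident C X \<and> q \<cdot>\<^bsub>C\<^esub> j = ident C Y \<and> p \<cdot>\<^bsub>C\<^esub> j = 0 \<and> q \<cdot>\<^bsub>C\<^esub> i = 0 \<and>
     i \<cdot>\<^bsub>C\<^esub> p + j \<cdot>\<^bsub>C\<^esub> q = ident C Z"

definition is_iso :: "('o, 'm, 'z) category_scheme \<Rightarrow> 'o \<Rightarrow> 'o \<Rightarrow> 'm \<Rightarrow> bool" where
  "is_iso C X Y f \<longleftrightarrow> f \<in> Hom C X Y \<and>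
     (\<exists>g\<in>Hom C Y X. g \<cdot>\<^bsub>C\<^esub> f = ident C X \<and> f \<cdot>\<^bsub>C\<^esub> g = ident C Y)"

definition isomorphic :: "('o, 'm, 'z) category_scheme \<Rightarrow> 'o \<Rightarrow> 'o \<Rightarrow> bool" where
  "isomorphic C X Y \<longleftrightarrow> X \<in> Obj C \<and> Y \<in> Obj C \<and> (\<exists>f. is_iso C X Y f)"

definition is_retract :: "('o, 'm, 'z) category_scheme \<Rightarrow> 'o \<Rightarrow> 'o \<Rightarrow> bool" where
  "is_retract C Y X \<longleftrightarrow> X \<in> Obj C \<and> Y \<in> Obj C \<and>
     (\<exists>i\<in>Hom C Y X. \<exists>r\<in>Hom C X Y. r \<cdot>\<^bsub>C\<^esub> i = ident C Y)"

locale additive_category =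
  fixes C :: "('o, 'm::ab_group_add, 'z) category_scheme" (structure)
  assumes ident_hom: "X \<in> Obj C \<Longrightarrow> ident C X \<in> Hom C X X"
    and comp_hom: "\<lbrakk>X \<in> Obj C; Y \<in> Obj C; Z \<in> Obj C; f \<in> Hom C X Y; g \<in> Hom C Y Z\<rbrakk>
      \<Longrightarrow> g \<cdot> f \<in> Hom C X Z"
    and comp_assoc: "\<lbrakk>W \<in> Obj C; X \<in> Obj C; Y \<in> Obj C; Z \<in> Obj C;
      f \<in> Hom C W X; g \<in> Hom C X Y; h \<in> Hom C Y Z\<rbrakk> \<Longrightarrow> (h \<cdot> g) \<cdot> f = h \<cdot> (g \<cdot> f)"
    and comp_ident_left: "\<lbrakk>X \<in> Obj C; Y \<in> Obj C; f \<in> Hom C X Y\<rbrakk> \<Longrightarrow> ident C Y \<cdot> f = f"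
    and comp_ident_right: "\<lbrakk>X \<in> Obj C; Y \<in> Obj C; f \<in> Hom C X Y\<rbrakk> \<Longrightarrow> f \<cdot> ident C X = f"
    and zero_hom: "\<lbrakk>X \<in> Obj C; Y \<in> Obj C\<rbrakk> \<Longrightarrow> 0 \<in> Hom C X Y"
    and add_hom: "\<lbrakk>X \<in> Obj C; Y \<in> Obj C; f \<in> Hom C X Y; f' \<in> Hom C X Y\<rbrakk> \<Longrightarrow> f + f' \<in> Hom C X Y"
    and uminus_hom: "\<lbrakk>X \<in> Obj C; Y \<in> Obj C; f \<in> Hom C X Y\<rbrakk> \<Longrightarrow> - f \<in> Hom C X Y"
    and comp_add_left: "\<lbrakk>X \<in> Obj C; Y \<in> Obj C; Z \<in> Obj C;
      f \<in> Hom C X Y; g \<in> Hom C Y Z; g' \<in> Hom C Y Z\<rbrakk> \<Longrightarrow> (g + g') \<cdot> f = g \<cdot> f + g' \<cdot> f"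
    and comp_add_right: "\<lbrakk>X \<in> Obj C; Y \<in> Obj C; Z \<in> Obj C;
      f \<in> Hom C X Y; f' \<in> Hom C X Y; g \<in> Hom C Y Z\<rbrakk> \<Longrightarrow> g \<cdot> (f + f') = g \<cdot> f + g \<cdot> f'"
    and ex_zero: "\<exists>Z. is_zero C Z"
    and ex_biproduct: "\<lbrakk>X \<in> Obj C; Y \<in> Obj C\<rbrakk> \<Longrightarrow> \<exists>Z i j p q. is_biproduct C X Y Z i j p q"

definition full_subcategory :: "('o, 'm, 'z) category_scheme \<Rightarrow> 'o set \<Rightarrow> ('o, 'm) category" where
  "full_subcategory C S = \<lparr>Obj = S, Hom = Hom C, ident = ident C, Comp = Comp C\<rparr>"


section \<open>Equivalence of additive categories\<close>

text \<open>As hom-sets may overlap, the action of a functor on morphisms is indexed by objects.\<close>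

record ('o, 'm, 'p, 'n) fun_data =
  on_obj :: "'o \<Rightarrow> 'p"
  on_mor :: "'o \<Rightarrow> 'o \<Rightarrow> 'm \<Rightarrow> 'n"

definition additive_functor ::
  "('o, 'm::ab_group_add, 'y) category_scheme \<Rightarrow> ('p, 'n::ab_group_add, 'z) category_scheme \<Rightarrow>
   ('o, 'm, 'p, 'n) fun_data \<Rightarrow> bool" where
  "additive_functor C D F \<longleftrightarrow>
     (\<forall>X\<in>Obj C. on_obj F X \<in> Obj D \<and> on_mor F X X (ident C X) = ident D (on_obj F X)) \<and>
     (\<forall>X\<in>Obj C. \<forall>Y\<in>Obj C. \<forall>f\<in>Hom C X Y. on_mor F X Y f \<in> Hom D (on_obj F X) (on_obj F Y)) \<and>
     (\<forall>X\<in>Obj C. \<forall>Y\<in>Obj C. \<forall>Z\<in>Obj C. \<forall>f\<in>Hom C X Y. \<forall>g\<in>Hom C Y Z.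
        on_mor F X Z (g \<cdot>\<^bsub>C\<^esub> f) = on_mor F Y Z g \<cdot>\<^bsub>D\<^esub> on_mor F X Y f) \<and>
     (\<forall>X\<in>Obj C. \<forall>Y\<in>Obj C. \<forall>f\<in>Hom C X Y. \<forall>g\<in>Hom C X Y.
        on_mor F X Y (f + g) = on_mor F X Y f + on_mor F X Y g)"

definition id_functor :: "('o, 'm, 'o, 'm) fun_data" where
  "id_functor = \<lparr>on_obj = (\<lambda>X. X), on_mor = (\<lambda>X Y f. f)\<rparr>"

definition comp_functor ::
  "('p, 'n, 'q, 'k) fun_data \<Rightarrow> ('o, 'm, 'p, 'n) fun_data \<Rightarrow> ('o, 'm, 'q, 'k) fun_data" where
  "comp_functor G F = \<lparr>on_obj = (\<lambda>X. on_obj G (on_obj F X)),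
     on_mor = (\<lambda>X Y f. on_mor G (on_obj F X) (on_obj F Y) (on_mor F X Y f))\<rparr>"

definition natural_iso ::
  "('o, 'm, 'y) category_scheme \<Rightarrow> ('p, 'n, 'z) category_scheme \<Rightarrow>
   ('o, 'm, 'p, 'n) fun_data \<Rightarrow> ('o, 'm, 'p, 'n) fun_data \<Rightarrow> ('o \<Rightarrow> 'n) \<Rightarrow> bool" where
  "natural_iso C D F G \<eta> \<longleftrightarrow>
     (\<forall>X\<in>Obj C. is_iso D (on_obj F X) (on_obj G X) (\<eta> X)) \<and>
     (\<forall>X\<in>Obj C. \<forall>Y\<in>Obj C. \<forall>f\<in>Hom C X Y. \<eta> Y \<cdot>\<^bsub>D\<^esub> on_mor F X Y f = on_mor G X Y f \<cdot>\<^bsub>D\<^esub> \<eta> X)"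

definition equivalent_categories ::
  "('o, 'm::ab_group_add, 'y) category_scheme \<Rightarrow> ('p, 'n::ab_group_add, 'z) category_scheme \<Rightarrow> bool" where
  "equivalent_categories C D \<longleftrightarrow>
     (\<exists>F G \<eta> \<epsilon>. additive_functor C D F \<and> additive_functor D C G \<and>
        natural_iso C C id_functor (comp_functor G F) \<eta> \<and>
        natural_iso D D (comp_functor F G) id_functor \<epsilon>)"


section \<open>Triangulated categories\<close>

type_synonym ('o, 'm) triangle = "'o \<times> 'o \<times> 'o \<times> 'm \<times> 'm \<times> 'm"

record ('o, 'm) shift_category = "('o, 'm) category" +
  Sh :: "'o \<Rightarrow> 'o"
  sh :: "'m \<Rightarrow> 'm"

record ('o, 'm) tri_category = "('o, 'm) shift_category" +
  Dist :: "('o, 'm) triangle set"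

text \<open>\<open>(X, Y, Z, f, g, h)\<close> stands for \<open>X \<rightarrow> Y \<rightarrow> Z \<rightarrow> X[1]\<close>.\<close>

fun is_triangle :: "('o, 'm, 'z) shift_category_scheme \<Rightarrow> ('o, 'm) triangle \<Rightarrow> bool" where
  "is_triangle C (X, Y, Z, f, g, h) \<longleftrightarrow> X \<in> Obj C \<and> Y \<in> Obj C \<and> Z \<in> Obj C \<and>
     f \<in> Hom C X Y \<and> g \<in> Hom C Y Z \<and> h \<in> Hom C Z (Sh C X)"

fun triangle_mor ::
  "('o, 'm, 'z) shift_category_scheme \<Rightarrow> ('o, 'm) triangle \<Rightarrow> ('o, 'm) triangle \<Rightarrow>
   'm \<times> 'm \<times> 'm \<Rightarrow> bool" where
  "triangle_mor C (X, Y, Z, f, g, h) (X', Y', Z', f', g', h') (a, b, c) \<longleftrightarrow>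
     a \<in> Hom C X X' \<and> b \<in> Hom C Y Y' \<and> c \<in> Hom C Z Z' \<and>
     b \<cdot>\<^bsub>C\<^esub> f = f' \<cdot>\<^bsub>C\<^esub> a \<and> c \<cdot>\<^bsub>C\<^esub> g = g' \<cdot>\<^bsub>C\<^esub> b \<and> sh C a \<cdot>\<^bsub>C\<^esub> h = h' \<cdot>\<^bsub>C\<^esub> c"

fun triangle_iso ::
  "('o, 'm, 'z) shift_category_scheme \<Rightarrow> ('o, 'm) triangle \<Rightarrow> ('o, 'm) triangle \<Rightarrow>
   'm \<times> 'm \<times> 'm \<Rightarrow> bool" where
  "triangle_iso C (X, Y, Z, f, g, h) (X', Y', Z', f', g', h') (a, b, c) \<longleftrightarrow>
     triangle_mor C (X, Y, Z, f, g, h) (X', Y', Z', f', g', h') (a, b, c) \<and>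
     is_iso C X X' a \<and> is_iso C Y Y' b \<and> is_iso C Z Z' c"

text \<open>The shift is an automorphism of the category, as in Verdier's definition.\<close>

locale triangulated_category = additive_category C
  for C :: "('o, 'm::ab_group_add, 'z) tri_category_scheme" (structure) +
  assumes Sh_bij: "bij_betw (Sh C) (Obj C) (Obj C)"
    and sh_bij: "\<lbrakk>X \<in> Obj C; Y \<in> Obj C\<rbrakk> \<Longrightarrow> bij_betw (sh C) (Hom C X Y) (Hom C (Sh C X) (Sh C Y))"
    and sh_ident: "X \<in> Obj C \<Longrightarrow> sh C (ident C X) = ident C (Sh C X)"
    and sh_comp: "\<lbrakk>X \<in> Obj C; Y \<in> Obj C; Z \<in> Obj C; f \<in> Hom C X Y; g \<in> Hom C Y Z\<rbrakk>
      \<Longrightarrow> sh C (g \<cdot> f) = sh C g \<cdot> sh C f"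
    and sh_add: "\<lbrakk>X \<in> Obj C; Y \<in> Obj C; f \<in> Hom C X Y; f' \<in> Hom C X Y\<rbrakk>
      \<Longrightarrow> sh C (f + f') = sh C f + sh C f'"
    and Dist_triangle: "T \<in> Dist C \<Longrightarrow> is_triangle C T"
    and TR1_iso: "\<lbrakk>T \<in> Dist C; is_triangle C T'; triangle_iso C T T' \<phi>\<rbrakk> \<Longrightarrow> T' \<in> Dist C"
    and TR1_ident: "\<lbrakk>X \<in> Obj C; is_zero C Z\<rbrakk> \<Longrightarrow> (X, X, Z, ident C X, 0, 0) \<in> Dist C"
    and TR1_cone: "\<lbrakk>X \<in> Obj C; Y \<in> Obj C; f \<in> Hom C X Y\<rbrakk> \<Longrightarrow> \<exists>Z g h. (X, Y, Z, f, g, h) \<in> Dist C"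
    and TR2: "is_triangle C (X, Y, Z, f, g, h) \<Longrightarrow>
      (X, Y, Z, f, g, h) \<in> Dist C \<longleftrightarrow> (Y, Z, Sh C X, g, h, - sh C f) \<in> Dist C"
    and TR3: "\<lbrakk>(X, Y, Z, f, g, h) \<in> Dist C; (X', Y', Z', f', g', h') \<in> Dist C;
      a \<in> Hom C X X'; b \<in> Hom C Y Y'; b \<cdot> f = f' \<cdot> a\<rbrakk>
      \<Longrightarrow> \<exists>c. triangle_mor C (X, Y, Z, f, g, h) (X', Y', Z', f', g', h') (a, b, c)"
    and TR4: "\<lbrakk>(X, Y, U, f, u, u') \<in> Dist C; (Y, Z, W, g, w, w') \<in> Dist C;
      (X, Z, V, g \<cdot> f, v, v') \<in> Dist C\<rbrakk>
      \<Longrightarrow> \<exists>a\<in>Hom C U V. \<exists>b\<in>Hom C V W. (U, V, W, a, b, sh C u \<cdot> w') \<in> Dist C \<and>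
            a \<cdot> u = v \<cdot> g \<and> v' \<cdot> a = u' \<and> b \<cdot> v = w \<and> sh C f \<cdot> v' = w' \<cdot> b"

text \<open>The object \<open>X[n]\<close>.\<close>

definition shift_by :: "('o, 'm, 'z) shift_category_scheme \<Rightarrow> int \<Rightarrow> 'o \<Rightarrow> 'o" where
  "shift_by C n X =
     (if n \<ge> 0 then (Sh C ^^ nat n) X else (inv_into (Obj C) (Sh C) ^^ nat (- n)) X)"

definition strictly_full_triangulated_subcategory ::
  "('o, 'm::ab_group_add, 'z) tri_category_scheme \<Rightarrow> 'o set \<Rightarrow> bool" where
  "strictly_full_triangulated_subcategory C D \<longleftrightarrow>
     D \<subseteq> Obj C \<and> (\<exists>Z\<in>D. is_zero C Z) \<and>
     (\<forall>X Y. X \<in> D \<longrightarrow> isomorphic C X Y \<longrightarrow> Y \<in> D) \<and>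
     (\<forall>X\<in>D. shift_by C 1 X \<in> D \<and> shift_by C (-1) X \<in> D) \<and>
     (\<forall>X Y Z f g h. (X, Y, Z, f, g, h) \<in> Dist C \<longrightarrow> X \<in> D \<longrightarrow> Y \<in> D \<longrightarrow> Z \<in> D)"

definition generates :: "('o, 'm::ab_group_add, 'z) tri_category_scheme \<Rightarrow> 'o set \<Rightarrow> bool" where
  "generates C S \<longleftrightarrow> S \<subseteq> Obj C \<and>
     \<Inter>{D. strictly_full_triangulated_subcategory C D \<and> S \<subseteq> D} = Obj C"


section \<open>Weight structures\<close>

definition additive_subclass ::
  "('o, 'm::ab_group_add, 'z) category_scheme \<Rightarrow> 'o set \<Rightarrow> bool" where
  "additive_subclass C S \<longleftrightarrow> S \<subseteq> Obj C \<and> (\<exists>Z\<in>S. is_zero C Z) \<and>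
     (\<forall>X Y Z i j p q. X \<in> S \<longrightarrow> Y \<in> S \<longrightarrow> is_biproduct C X Y Z i j p q \<longrightarrow> Z \<in> S)"

definition Karoubi_closed :: "('o, 'm, 'z) category_scheme \<Rightarrow> 'o set \<Rightarrow> bool" where
  "Karoubi_closed C S \<longleftrightarrow> (\<forall>X Y. X \<in> S \<longrightarrow> is_retract C Y X \<longrightarrow> Y \<in> S)"

definition orthogonal ::
  "('o, 'm::ab_group_add, 'z) category_scheme \<Rightarrow> 'o set \<Rightarrow> 'o set \<Rightarrow> bool" where
  "orthogonal C D E \<longleftrightarrow> (\<forall>X\<in>D. \<forall>Y\<in>E. Hom C X Y = {0})"

definition weight_structure ::
  "('o, 'm::ab_group_add, 'z) tri_category_scheme \<Rightarrow> 'o set \<Rightarrow> 'o set \<Rightarrow> bool" where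
  "weight_structure C w_le w_ge \<longleftrightarrow>
     additive_subclass C w_le \<and> additive_subclass C w_ge \<and>
     Karoubi_closed C w_le \<and> Karoubi_closed C w_ge \<and>
     w_ge \<subseteq> shift_by C 1 ` w_ge \<and> shift_by C 1 ` w_le \<subseteq> w_le \<and>
     orthogonal C w_ge (shift_by C 1 ` w_le) \<and>
     (\<forall>X\<in>Obj C. \<exists>A\<in>w_le. \<exists>B\<in>w_ge. \<exists>f g h. (shift_by C (-1) B, X, A, f, g, h) \<in> Dist C)"

definition bounded_weight_structure ::
  "('o, 'm::ab_group_add, 'z) tri_category_scheme \<Rightarrow> 'o set \<Rightarrow> 'o set \<Rightarrow> bool" where
  "bounded_weight_structure C w_le w_ge \<longleftrightarrow> weight_structure C w_le w_ge \<and>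
     (\<Union>l::int. shift_by C (- l) ` w_le) = Obj C \<and>
     (\<Union>l::int. shift_by C (- l) ` w_ge) = Obj C"

definition heart ::
  "('o, 'm, 'z) category_scheme \<Rightarrow> 'o set \<Rightarrow> 'o set \<Rightarrow> ('o, 'm) category" where
  "heart C w_le w_ge = full_subcategory C (w_ge \<inter> w_le)"


section \<open>Idempotent completion\<close>

definition idem_completion ::
  "('o, 'm, 'z) category_scheme \<Rightarrow> ('o \<times> 'm, 'm) category" where
  "idem_completion A =
     \<lparr>Obj = {(X, p). X \<in> Obj A \<and> p \<in> Hom A X X \<and> p \<cdot>\<^bsub>A\<^esub> p = p},
      Hom = (\<lambda>(X, p) (X', p'). {f \<in> Hom A X X'. p' \<cdot>\<^bsub>A\<^esub> f = f \<and> f \<cdot>\<^bsub>A\<^esub> p = f}),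
      ident = snd,
      Comp = Comp A\<rparr>"

definition idem_embedding :: "('o, 'm, 'z) category_scheme \<Rightarrow> 'o \<Rightarrow> 'o \<times> 'm" where
  "idem_embedding A X = (X, ident A X)"

fun idem_embedding_triangle ::
  "('o, 'm, 'z) category_scheme \<Rightarrow> ('o, 'm) triangle \<Rightarrow> ('o \<times> 'm, 'm) triangle" where
  "idem_embedding_triangle A (X, Y, Z, f, g, h) =
     (idem_embedding A X, idem_embedding A Y, idem_embedding A Z, f, g, h)"

definition idem_shift_completion ::
  "('o, 'm, 'z) shift_category_scheme \<Rightarrow> ('o \<times> 'm, 'm) shift_category" where
  "idem_shift_completion C =
     \<lparr>Obj = Obj (idem_completion C), Hom = Hom (idem_completion C),
      ident = ident (idem_completion C), Comp = Comp (idem_completion C),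
      Sh = (\<lambda>(X, p). (Sh C X, sh C p)), sh = sh C\<rparr>"

text \<open>\<open>S\<close> is a direct summand of \<open>T\<close>: there is a complement \<open>S'\<close> and a biproduct decomposition
  \<open>T = S \<oplus> S'\<close> whose injections and projections are morphisms of triangles.\<close>

fun triangle_biproduct ::
  "('o, 'm::ab_group_add, 'z) shift_category_scheme \<Rightarrow>
   ('o, 'm) triangle \<Rightarrow> ('o, 'm) triangle \<Rightarrow> ('o, 'm) triangle \<Rightarrow>
   'm \<times> 'm \<times> 'm \<Rightarrow> 'm \<times> 'm \<times> 'm \<Rightarrow> 'm \<times> 'm \<times> 'm \<Rightarrow> 'm \<times> 'm \<times> 'm \<Rightarrow> bool" where
  "triangle_biproduct C (X, Y, Z, f, g, h) (X', Y', Z', f', g', h') (X'', Y'', Z'', f'', g'', h'')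
     (i1, i2, i3) (j1, j2, j3) (p1, p2, p3) (q1, q2, q3) \<longleftrightarrow>
     is_biproduct C X X' X'' i1 j1 p1 q1 \<and>
     is_biproduct C Y Y' Y'' i2 j2 p2 q2 \<and>
     is_biproduct C Z Z' Z'' i3 j3 p3 q3 \<and>
     triangle_mor C (X, Y, Z, f, g, h) (X'', Y'', Z'', f'', g'', h'') (i1, i2, i3) \<and>
     triangle_mor C (X', Y', Z', f', g', h') (X'', Y'', Z'', f'', g'', h'') (j1, j2, j3) \<and>
     triangle_mor C (X'', Y'', Z'', f'', g'', h'') (X, Y, Z, f, g, h) (p1, p2, p3) \<and>
     triangle_mor C (X'', Y'', Z'', f'', g'', h'') (X', Y', Z', f', g', h') (q1, q2, q3)"

definition triangle_summand ::
  "('o, 'm::ab_group_add, 'z) shift_category_scheme \<Rightarrow>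
   ('o, 'm) triangle \<Rightarrow> ('o, 'm) triangle \<Rightarrow> bool" where
  "triangle_summand C S T \<longleftrightarrow> is_triangle C S \<and>
     (\<exists>S' i j p q. is_triangle C S' \<and> triangle_biproduct C S S' T i j p q)"

text \<open>The triangulation of Balmer and Schlichting.\<close>

definition idem_tri_completion ::
  "('o, 'm::ab_group_add, 'z) tri_category_scheme \<Rightarrow> ('o \<times> 'm, 'm) tri_category" where
  "idem_tri_completion C =
     \<lparr>Obj = Obj (idem_shift_completion C), Hom = Hom (idem_shift_completion C),
      ident = ident (idem_shift_completion C), Comp = Comp (idem_shift_completion C),
      Sh = Sh (idem_shift_completion C), sh = sh (idem_shift_completion C),
      Dist = {S. \<exists>T\<in>Dist C.
        triangle_summand (idem_shift_completion C) S (idem_embedding_triangle C T)}\<rparr>"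

text \<open>The weight structure \<open>(w_le', w_ge')\<close> on the idempotent completion of \<open>C\<close> restricts to
  \<open>(w_le, w_ge)\<close> along the canonical embedding.\<close>

definition extends_weight_structure ::
  "('o, 'm, 'z) category_scheme \<Rightarrow> ('o \<times> 'm) set \<Rightarrow> ('o \<times> 'm) set \<Rightarrow> 'o set \<Rightarrow> 'o set \<Rightarrow> bool" where
  "extends_weight_structure C w_le' w_ge' w_le w_ge \<longleftrightarrow>
     w_le = {X \<in> Obj C. idem_embedding C X \<in> w_le'} \<and>
     w_ge = {X \<in> Obj C. idem_embedding C X \<in> w_ge'}"

end

theory Submission
  imports Defs "HOL-Library.Function_Algebras"
begin

text \<open>
  The weight classes of the idempotent completion consist of the retracts of objects of the
  given ones; only weight decompositions need an argument. Let \<open>M = (X, p)\<close>. A cone of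
  \<open>1 - p\<close> is \<open>M \<oplus> M[1]\<close>, and for odd \<open>m\<close> a cone of the map
  \<open>M[m] \<oplus> M[m+1] \<rightarrow> M \<oplus> M[m]\<close> through \<open>M[m]\<close> is \<open>M \<oplus> M[m+2]\<close>; so all
  \<open>N = M \<oplus> M[m]\<close> with \<open>m\<close> odd come from objects of \<open>C\<close>. If \<open>m\<close> is large, then \<open>M[m]\<close> has
  nonpositive weights, hence the map \<open>B[-1] \<rightarrow> N\<close> of a weight decomposition
  \<open>B[-1] \<rightarrow> N \<rightarrow> A \<rightarrow> B\<close> has no component in \<open>M[m]\<close>. The trivial triangle on \<open>M[m]\<close> therefore
  splits off and leaves a weight decomposition \<open>B[-1] \<rightarrow> M \<rightarrow> A' \<rightarrow> B\<close> with \<open>A'\<close> a retract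
  of \<open>A\<close>. If \<open>M\<close> has nonnegative weights, then \<open>A'\<close> lies in the heart, and \<open>B\<close> is an object of
  \<open>C\<close>, hence an iterated extension of shifts of objects of the heart of \<open>C\<close>; this gives the
  generation statement. No axiom of a triangulated category is needed for the completion: all
  constructions are carried out in \<open>C\<close>.
\<close>

section \<open>Representing morphisms by operators\<close>

context additive_category
begin

lemma minus_hom: "\<lbrakk>X \<in> Obj C; Y \<in> Obj C; f \<in> Hom C X Y; g \<in> Hom C X Y\<rbrakk> \<Longrightarrow> f - g \<in> Hom C X Y"
  using add_hom[of X Y f "- g"] uminus_hom[of X Y g] by simp

lemma comp_zero_right [simp]:
  assumes "X \<in> Obj C" "Y \<in> Obj C" "Z \<in> Obj C" "g \<in> Hom C Y Z"
  shows "g \<cdot> 0 = 0"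
  using comp_add_right[of X Y Z 0 0 g] zero_hom[of X Y] assms by simp

lemma comp_zero_left [simp]:
  assumes "X \<in> Obj C" "Y \<in> Obj C" "Z \<in> Obj C" "f \<in> Hom C X Y"
  shows "0 \<cdot> f = 0"
  using comp_add_left[of X Y Z f 0 0] zero_hom[of Y Z] assms by simp

text \<open>Generalized elements: families \<open>u\<close> with \<open>u T X \<in> Hom C T X\<close>. Acting on them represents
  morphisms faithfully by operators whose composition is associative without any typing
  conditions.\<close>

definition families :: "('o \<Rightarrow> 'o \<Rightarrow> 'm) set" where
  "families = {u. \<forall>T\<in>Obj C. \<forall>X\<in>Obj C. u T X \<in> Hom C T X}"

text \<open>This is postcomposition with \<open>f\<close>, concentrated in the component
  \<open>Y\<close>. The value 0 outside \<open>families\<close> keeps every output inside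
  \<open>families\<close>, whatever the argument.\<close>

definition opr :: "'o \<Rightarrow> 'o \<Rightarrow> 'm \<Rightarrow> ('o \<Rightarrow> 'o \<Rightarrow> 'm) \<Rightarrow> 'o \<Rightarrow> 'o \<Rightarrow> 'm" where
  "opr X Y f = (\<lambda>u T Z. if u \<in> families \<and> T \<in> Obj C \<and> Z = Y then f \<cdot> u T X else 0)"

text \<open>Composition of functions distributes over sums in its left argument automatically. In
  the right argument additivity is required, and the range condition guarantees that it is only ever
  applied to members of \<open>families\<close>.\<close>

definition operators :: "(('o \<Rightarrow> 'o \<Rightarrow> 'm) \<Rightarrow> 'o \<Rightarrow> 'o \<Rightarrow> 'm) set" where
  "operators = {F. range F \<subseteq> families \<and> (\<forall>u\<in>families. \<forall>v\<in>families. F (u + v) = F u + F v)}"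

lemma families_add: "\<lbrakk>u \<in> families; v \<in> families\<rbrakk> \<Longrightarrow> u + v \<in> families"
  by (auto simp: families_def add_hom)

lemma families_uminus: "u \<in> families \<Longrightarrow> - u \<in> families"
  by (auto simp: families_def uminus_hom)

lemma families_zero: "0 \<in> families"
  by (auto simp: families_def zero_hom)

lemma operators_add [simp]: "\<lbrakk>F \<in> operators; G \<in> operators\<rbrakk> \<Longrightarrow> F + G \<in> operators"
  by (auto simp: operators_def image_subset_iff families_add)

lemma operators_uminus [simp]: "F \<in> operators \<Longrightarrow> - F \<in> operators"
  by (auto simp: operators_def image_subset_iff families_uminus)

lemma operators_minus [simp]: "\<lbrakk>F \<in> operators; G \<in> operators\<rbrakk> \<Longrightarrow> F - G \<in> operators"
  using operators_add[of F "- G"] by simp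

lemma operators_zero [simp]: "0 \<in> operators"
  by (auto simp: operators_def families_zero)

lemma operators_comp [simp]: "\<lbrakk>F \<in> operators; G \<in> operators\<rbrakk> \<Longrightarrow> F \<circ> G \<in> operators"
  by (auto simp: operators_def image_subset_iff)

lemma opr_operators [simp]:
  assumes "X \<in> Obj C" "Y \<in> Obj C" "f \<in> Hom C X Y"
  shows "opr X Y f \<in> operators"
proof -
  have "opr X Y f u \<in> families" for u
    using assms by (auto simp: opr_def families_def zero_hom comp_hom)
  moreover have "opr X Y f (u + v) = opr X Y f u + opr X Y f v"
    if "u \<in> families" "v \<in> families" for u v
  proof -
    have "u T X \<in> Hom C T X" "v T X \<in> Hom C T X" if "T \<in> Obj C" for T
      using \<open>u \<in> families\<close> \<open>v \<in> families\<close> that assms by (auto simp: families_def)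
    then show ?thesis
      using that assms
      by (auto simp: opr_def families_add comp_add_right fun_eq_iff)
  qed
  ultimately show ?thesis
    by (auto simp: operators_def)
qed

lemma comp_plus_distrib:
  assumes "F \<in> operators" "G \<in> operators" "H \<in> operators"
  shows "F \<circ> (G + H) = (F \<circ> G) + (F \<circ> H)"
  using assms by (auto simp: operators_def image_subset_iff fun_eq_iff)

lemma comp_zero_distrib:
  assumes "F \<in> operators"
  shows "F \<circ> (0 :: ('o \<Rightarrow> 'o \<Rightarrow> 'm) \<Rightarrow> 'o \<Rightarrow> 'o \<Rightarrow> 'm) = 0"
  using comp_plus_distrib[OF assms operators_zero operators_zero] by simp

lemma comp_uminus_distrib:
  assumes "F \<in> operators" "G \<in> operators"
  shows "F \<circ> (- G) = - (F \<circ> G)"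
  using comp_plus_distrib[OF assms(1,2), of "- G"] assms
  by (simp add: comp_zero_distrib eq_neg_iff_add_eq_0 add.commute)

lemma comp_minus_distrib:
  assumes "F \<in> operators" "G \<in> operators" "H \<in> operators"
  shows "F \<circ> (G - H) = (F \<circ> G) - (F \<circ> H)"
  using comp_plus_distrib[OF assms(1,2), of "- H"] assms by (simp add: comp_uminus_distrib)

lemma plus_comp_distrib: "(F + G) \<circ> H = (F \<circ> H) + (G \<circ> H)" for F G H :: "'x::ab_group_add \<Rightarrow> 'x"
  by (simp add: fun_eq_iff)

lemma zero_comp_distrib: "0 \<circ> H = 0" for H :: "'x::ab_group_add \<Rightarrow> 'x"
  by (simp add: fun_eq_iff)

lemma uminus_comp_distrib: "(- F) \<circ> H = - (F \<circ> H)" for F H :: "'x::ab_group_add \<Rightarrow> 'x"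
  by (simp add: fun_eq_iff)

lemma minus_comp_distrib: "(F - G) \<circ> H = (F \<circ> H) - (G \<circ> H)" for F G H :: "'x::ab_group_add \<Rightarrow> 'x"
  by (simp add: fun_eq_iff)

text \<open>Yoneda argument: evaluation at the family that is the identity of \<open>X\<close> in
  one component and 0 elsewhere recovers the morphism.\<close>

lemma opr_eqI:
  assumes "opr X Y f = opr X Y g"
    and "X \<in> Obj C" "Y \<in> Obj C" "f \<in> Hom C X Y" "g \<in> Hom C X Y"
  shows "f = g"
proof -
  define u where "u = (\<lambda>T Z. if T = X \<and> Z = X then ident C X else 0)"
  have "u \<in> families"
    using assms by (auto simp: u_def families_def zero_hom ident_hom)
  then have "opr X Y h u X Y = h" if "h \<in> Hom C X Y" for h
    using assms that by (simp add: opr_def u_def comp_ident_right)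
  then show ?thesis
    using assms by metis
qed

text \<open>The first premise is meant to determine the object in the middle when the rule is used
  for rewriting.\<close>

lemma opr_comp:
  assumes "g \<in> Hom C Y Z" "f \<in> Hom C X Y" "X \<in> Obj C" "Y \<in> Obj C" "Z \<in> Obj C"
  shows "opr X Z (g \<cdot> f) = opr Y Z g \<circ> opr X Y f"
proof -
  have "u T X \<in> Hom C T X" if "u \<in> families" "T \<in> Obj C" for u T
    using that assms by (auto simp: families_def)
  moreover have "opr X Y f u \<in> families" for u
    using opr_operators[OF assms(3,4,2)] by (auto simp: operators_def)
  moreover have "opr X Y f u T Y = f \<cdot> u T X" if "u \<in> families" "T \<in> Obj C" for u T
    using that by (simp add: opr_def)
  moreover have "opr X Y f u T Y = 0" if "u \<notin> families" for u T
    using that by (simp add: opr_def)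
  moreover have "opr Y Z g u' T Z' = g \<cdot> u' T Y" if "u' \<in> families" "T \<in> Obj C" "Z' = Z" for u' T Z'
    using that by (simp add: opr_def)
  \<comment> \<open>For \<open>u\<close> outside \<open>families\<close> the inner operator yields
    0, to which the right-hand side still applies \<open>g\<close>.\<close>
  moreover have "g \<cdot> 0 = 0"
    by (rule comp_zero_right[of X Y Z]) (use assms in auto)
  ultimately have "opr X Z (g \<cdot> f) u T Z' = opr Y Z g (opr X Y f u) T Z'" for u T Z'
    using assms
    by (cases "u \<in> families"; cases "T \<in> Obj C"; cases "Z' = Z") (auto simp: opr_def[of _ Z] comp_assoc)
  then show ?thesis
    by (simp add: fun_eq_iff)
qed

lemma opr_add:
  assumes "f \<in> Hom C X Y" "g \<in> Hom C X Y" "X \<in> Obj C" "Y \<in> Obj C"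
  shows "opr X Y (f + g) = opr X Y f + opr X Y g"
  using assms by (auto simp: opr_def fun_eq_iff families_def comp_add_left)

lemma opr_zero: "\<lbrakk>X \<in> Obj C; Y \<in> Obj C\<rbrakk> \<Longrightarrow> opr X Y 0 = 0"
  using opr_add[of 0 X Y 0] zero_hom by simp

lemma opr_uminus:
  assumes "f \<in> Hom C X Y" "X \<in> Obj C" "Y \<in> Obj C"
  shows "opr X Y (- f) = - opr X Y f"
  using opr_add[of f X Y "- f"] uminus_hom assms
  by (simp add: opr_zero eq_neg_iff_add_eq_0 add.commute)

lemma opr_minus:
  assumes "f \<in> Hom C X Y" "g \<in> Hom C X Y" "X \<in> Obj C" "Y \<in> Obj C"
  shows "opr X Y (f - g) = opr X Y f - opr X Y g"
  using opr_add[of f X Y "- g"] uminus_hom assms by (simp add: opr_uminus)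

lemma opr_ident_left [simp]:
  assumes "X \<in> Obj C" "Y \<in> Obj C" "f \<in> Hom C X Y"
  shows "opr Y Y (ident C Y) \<circ> opr X Y f = opr X Y f"
  using assms opr_comp[of "ident C Y" Y Y f X] by (simp add: ident_hom comp_ident_left)

lemma opr_ident_right [simp]:
  assumes "X \<in> Obj C" "Y \<in> Obj C" "f \<in> Hom C X Y"
  shows "opr X Y f \<circ> opr X X (ident C X) = opr X Y f"
  using assms opr_comp[of f X Y "ident C X" X] by (simp add: ident_hom comp_ident_right)

lemma opr_ident_left_assoc [simp]:
  assumes "X \<in> Obj C" "Y \<in> Obj C" "f \<in> Hom C X Y"
  shows "opr Y Y (ident C Y) \<circ> (opr X Y f \<circ> H) = opr X Y f \<circ> H"
  using opr_ident_left[OF assms] by (simp add: o_assoc)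

lemma opr_ident_right_assoc [simp]:
  assumes "X \<in> Obj C" "Y \<in> Obj C" "f \<in> Hom C X Y"
  shows "opr X Y f \<circ> (opr X X (ident C X) \<circ> H) = opr X Y f \<circ> H"
  using opr_ident_right[OF assms] by (simp add: o_assoc)

text \<open>With the premises exchanged, the middle object can also be found from the typing of
  \<open>f\<close>. The rules \<open>comp_homI\<close> and \<open>comp_homI'\<close> form an
  analogous pair.\<close>

lemma opr_comp':
  assumes "f \<in> Hom C X Y" "g \<in> Hom C Y Z" "X \<in> Obj C" "Y \<in> Obj C" "Z \<in> Obj C"
  shows "opr X Z (g \<cdot> f) = opr Y Z g \<circ> opr X Y f"
  using opr_comp[OF assms(2,1,3-5)] .

lemma comp_homI:
  assumes "g \<in> Hom C Y Z" "f \<in> Hom C X Y" "X \<in> Obj C" "Y \<in> Obj C" "Z \<in> Obj C"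
  shows "g \<cdot> f \<in> Hom C X Z"
  using assms by (intro comp_hom[of X Y Z])

lemma comp_homI':
  assumes "f \<in> Hom C X Y" "g \<in> Hom C Y Z" "X \<in> Obj C" "Y \<in> Obj C" "Z \<in> Obj C"
  shows "g \<cdot> f \<in> Hom C X Z"
  using assms by (intro comp_hom[of X Y Z])

text \<open>These rules rewrite the operator of a composite morphism into a sum of right-associated
  composites of basic operators. Equations between morphisms are then proved by
  \<open>opr_eqI\<close> followed by simplification.\<close>

lemmas opr_simps = opr_comp opr_comp' opr_add opr_minus opr_uminus opr_zero
  comp_plus_distrib comp_minus_distrib comp_uminus_distrib comp_zero_distrib
  plus_comp_distrib minus_comp_distrib uminus_comp_distrib zero_comp_distrib
  comp_homI comp_homI' add_hom minus_hom uminus_hom zero_hom ident_hom Fun.comp_assoc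

text \<open>Instances of this rule and of \<open>opr_eq_assoc\<close> pass a known relation
  \<open>g \<cdot> f = k\<close> to the simplifier; the second one serves occurrences inside a
  longer right-associated composite.\<close>

lemma opr_eq:
  assumes "g \<in> Hom C Y Z" "f \<in> Hom C X Y" "g \<cdot> f = k"
    and "X \<in> Obj C" "Y \<in> Obj C" "Z \<in> Obj C"
  shows "opr Y Z g \<circ> opr X Y f = opr X Z k"
  using opr_comp[OF assms(1,2,4,5,6)] assms(3) by simp

lemma opr_eq_assoc:
  assumes "g \<in> Hom C Y Z" "f \<in> Hom C X Y" "g \<cdot> f = k"
    and "X \<in> Obj C" "Y \<in> Obj C" "Z \<in> Obj C"
  shows "opr Y Z g \<circ> (opr X Y f \<circ> H) = opr X Z k \<circ> H"
  using opr_eq[OF assms] by (simp add: o_assoc)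

lemmas opr_eqs = opr_eq opr_eq_assoc

lemmas hom_simps = comp_homI comp_homI' add_hom minus_hom uminus_hom zero_hom ident_hom

lemma comp_uminus_left:
  assumes "f \<in> Hom C X Y" "g \<in> Hom C Y Z" "X \<in> Obj C" "Y \<in> Obj C" "Z \<in> Obj C"
  shows "- g \<cdot> f = - (g \<cdot> f)"
  using assms by (intro opr_eqI[of X Z]) (simp_all add: opr_simps)

lemma comp_uminus_right:
  assumes "f \<in> Hom C X Y" "g \<in> Hom C Y Z" "X \<in> Obj C" "Y \<in> Obj C" "Z \<in> Obj C"
  shows "g \<cdot> - f = - (g \<cdot> f)"
  using assms by (intro opr_eqI[of X Z]) (simp_all add: opr_simps)

end

section \<open>Exact triangles and cones\<close>

lemma (in additive_category) is_zeroI: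
  assumes "Z \<in> Obj C" "ident C Z = 0"
  shows "is_zero C Z"
proof -
  have "f = 0" if "X \<in> Obj C" "f \<in> Hom C Z X" for X f
    using comp_ident_right[of Z X f] that assms by simp
  moreover have "f = 0" if "X \<in> Obj C" "f \<in> Hom C X Z" for X f
    using comp_ident_left[of X Z f] that assms comp_zero_left by metis
  ultimately show ?thesis
    using assms by (auto simp: is_zero_def zero_hom)
qed

section \<open>Exactness of the Hom functors on distinguished triangles\<close>

context triangulated_category
begin

lemma Sh_Obj [simp]: "X \<in> Obj C \<Longrightarrow> Sh C X \<in> Obj C"
  using Sh_bij by (auto simp: bij_betw_def)

lemma sh_hom: "\<lbrakk>X \<in> Obj C; Y \<in> Obj C; f \<in> Hom C X Y\<rbrakk> \<Longrightarrow> sh C f \<in> Hom C (Sh C X) (Sh C Y)"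
  using sh_bij by (auto simp: bij_betw_def)

lemma Sh_surj:
  assumes "X \<in> Obj C"
  obtains X0 where "X0 \<in> Obj C" "X = Sh C X0"
  using assms Sh_bij by (auto simp: bij_betw_def)

lemma sh_surj:
  assumes "X \<in> Obj C" "Y \<in> Obj C" "f \<in> Hom C (Sh C X) (Sh C Y)"
  obtains f0 where "f0 \<in> Hom C X Y" "f = sh C f0"
  using assms sh_bij[of X Y] by (auto simp: bij_betw_def)

lemma sh_inj:
  assumes "X \<in> Obj C" "Y \<in> Obj C" "f \<in> Hom C X Y" "g \<in> Hom C X Y" "sh C f = sh C g"
  shows "f = g"
  using assms sh_bij[of X Y] by (auto simp: bij_betw_def inj_on_def)

lemma sh_zero [simp]: "sh C 0 = 0"
proof -
  obtain Z where "is_zero C Z"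
    using ex_zero by blast
  then have "Z \<in> Obj C"
    by (simp add: is_zero_def)
  then show ?thesis
    using sh_add[of Z Z 0 0] zero_hom by simp
qed

lemma sh_uminus: "\<lbrakk>X \<in> Obj C; Y \<in> Obj C; f \<in> Hom C X Y\<rbrakk> \<Longrightarrow> sh C (- f) = - sh C f"
  using sh_add[of X Y f "- f"] uminus_hom[of X Y f] by (simp add: eq_neg_iff_add_eq_0 add.commute)

lemma is_zero_Sh:
  assumes "is_zero C Z"
  shows "is_zero C (Sh C Z)"
proof (rule is_zeroI)
  have Z: "Z \<in> Obj C" "Hom C Z Z = {0}"
    using assms by (auto simp: is_zero_def)
  then have "ident C Z = 0"
    using ident_hom by blast
  then show "ident C (Sh C Z) = 0"
    using sh_ident[of Z] Z by simp
  show "Sh C Z \<in> Obj C"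
    using Z by simp
qed

lemma DistD:
  assumes "(X, Y, Z, f, g, h) \<in> Dist C"
  shows "X \<in> Obj C" "Y \<in> Obj C" "Z \<in> Obj C" "f \<in> Hom C X Y" "g \<in> Hom C Y Z" "h \<in> Hom C Z (Sh C X)"
  using Dist_triangle[OF assms] by auto

lemma rotate:
  assumes "(X, Y, Z, f, g, h) \<in> Dist C"
  shows "(Y, Z, Sh C X, g, h, - sh C f) \<in> Dist C"
  using assms TR2[OF Dist_triangle[OF assms]] by blast

text \<open>The identity of \<open>X\<close> and \<open>f\<close> map the trivial triangle X = X
  \<rightarrow> 0 to the given one; the third component shows that \<open>g \<cdot> f\<close>
  factors through a zero object.\<close>

lemma dist_comp_zero:
  assumes T: "(X, Y, Z, f, g, h) \<in> Dist C"
  shows "g \<cdot> f = 0"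
proof -
  note t = DistD[OF T]
  obtain Q where Q: "is_zero C Q"
    using ex_zero by blast
  have fX: "f \<in> Hom C X Y" "f \<cdot> ident C X = f"
    using t comp_ident_right by auto
  obtain c where "triangle_mor C (X, X, Q, ident C X, 0, 0) (X, Y, Z, f, g, h) (ident C X, f, c)"
    using TR3[OF TR1_ident[OF t(1) Q] T ident_hom[OF t(1)] fX(1)] by auto
  then have c: "c \<in> Hom C Q Z" "c \<cdot> 0 = g \<cdot> f"
    by auto
  moreover have "c \<cdot> 0 = 0"
    using c(1) comp_zero_right[of X Q Z c] Q t by (auto simp: is_zero_def)
  ultimately show ?thesis by simp
qed

text \<open>Exactness of Hom(W, -) at \<open>Y\<close>. \<open>TR3\<close>, applied to the rotated
  triangles W \<rightarrow> 0 \<rightarrow> W[1] and Y \<rightarrow> Z \<rightarrow> X[1], yields a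
  map W[1] \<rightarrow> X[1], and its desuspension is the lift.\<close>

lemma dist_lift:
  assumes T: "(X, Y, Z, f, g, h) \<in> Dist C" and W: "W \<in> Obj C" and a: "a \<in> Hom C W Y" "g \<cdot> a = 0"
  obtains b where "b \<in> Hom C W X" "f \<cdot> b = a"
proof -
  note t = DistD[OF T]
  obtain Q where Q: "is_zero C Q"
    using ex_zero by blast
  then have Q0: "Q \<in> Obj C" "0 \<in> Hom C Q Z"
    using t zero_hom by (auto simp: is_zero_def)
  have 0: "0 \<cdot> 0 = g \<cdot> a"
    using a comp_zero_left[of Q Q Z 0] Q0 t zero_hom by auto
  obtain c where c: "triangle_mor C (W, Q, Sh C W, 0, 0, - sh C (ident C W)) (Y, Z, Sh C X, g, h, - sh C f) (a, 0, c)"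
    using TR3[OF rotate[OF TR1_ident[OF W Q]] rotate[OF T] a(1) Q0(2)] a(2)
      comp_zero_left[of W Q Z 0] Q0 W t zero_hom by auto
  then have c': "c \<in> Hom C (Sh C W) (Sh C X)"
    and eq: "sh C a \<cdot> - sh C (ident C W) = - sh C f \<cdot> c"
    by auto
  obtain b where b: "b \<in> Hom C W X" "c = sh C b"
    using sh_surj c' W t by metis
  note ty = sh_hom[OF W t(2) a(1)] sh_hom[OF t(1,2,4)] sh_hom[OF W t(1) b(1)]
  have "sh C (f \<cdot> b) = sh C f \<cdot> sh C b"
    using sh_comp b W t by metis
  also have "\<dots> = sh C a"
  proof -
    \<comment> \<open>Each of the two rotations contributes a sign, and the two signs
      cancel.\<close>
    have "opr (Sh C W) (Sh C Y) (sh C a \<cdot> - ident C (Sh C W)) = opr (Sh C W) (Sh C Y) (- sh C f \<cdot> sh C b)"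
      using eq unfolding b(2) sh_ident[OF W] by simp
    then show ?thesis
      using ty W t by (intro opr_eqI[of "Sh C W" "Sh C Y"]) (simp_all add: opr_simps)
  qed
  finally have "f \<cdot> b = a"
    using sh_inj[of W Y] W t b a comp_homI by metis
  then show ?thesis
    using that b by blast
qed

text \<open>Exactness of Hom(-, W) at \<open>Y\<close>: the given triangle is mapped by
  \<open>TR3\<close> to the triangle 0 \<rightarrow> W = W \<rightarrow> 0.\<close>

lemma dist_extend:
  assumes T: "(X, Y, Z, f, g, h) \<in> Dist C" and W: "W \<in> Obj C" and a: "a \<in> Hom C Y W" "a \<cdot> f = 0"
  obtains b where "b \<in> Hom C Z W" "b \<cdot> g = a"
proof -
  note t = DistD[OF T]
  obtain Q where Q: "is_zero C Q"
    using ex_zero by blast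
  then have Q0: "Q \<in> Obj C" "0 \<in> Hom C Q W" "0 \<in> Hom C X Q"
    using t W zero_hom by (auto simp: is_zero_def)
  \<comment> \<open>The target triangle arises by undoing one rotation of a trivial triangle, whose
    third vertex must therefore be written as the shift of a zero object.\<close>
  have "(W, W, Sh C Q, ident C W, 0, - sh C 0) \<in> Dist C"
    using TR1_ident[OF W is_zero_Sh[OF Q]] by simp
  moreover have "is_triangle C (Q, W, W, 0, ident C W, 0)"
    using Q0 W ident_hom zero_hom by auto
  ultimately have T': "(Q, W, W, 0, ident C W, 0) \<in> Dist C"
    using TR2 by blast
  have "a \<cdot> f = 0 \<cdot> 0"
    using a comp_zero_right[of X Q W 0] Q0 W t by auto
  then obtain b where "triangle_mor C (X, Y, Z, f, g, h) (Q, W, W, 0, ident C W, 0) (0, a, b)"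
    using TR3[OF T T' Q0(3) a(1)] by auto
  then show ?thesis
    using that[of b] a(1) t W comp_ident_left by auto
qed

text \<open>The remaining exactness statements follow by rotation; the sign in
  \<open>- sh C f\<close> affects neither vanishing nor lifting.\<close>

lemma dist_comp_zero2: "(X, Y, Z, f, g, h) \<in> Dist C \<Longrightarrow> h \<cdot> g = 0"
  using dist_comp_zero[OF rotate] .

lemma dist_comp_zero3:
  assumes T: "(X, Y, Z, f, g, h) \<in> Dist C"
  shows "sh C f \<cdot> h = 0"
proof -
  note t = DistD[OF T]
  have "- sh C f \<cdot> h = - (sh C f \<cdot> h)"
    using t by (intro comp_uminus_left[OF t(6) sh_hom[OF t(1,2,4)]]) simp_all
  then show ?thesis
    using dist_comp_zero2[OF rotate[OF T]] by simp
qed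

lemma dist_lift2:
  assumes T: "(X, Y, Z, f, g, h) \<in> Dist C" and W: "W \<in> Obj C" and a: "a \<in> Hom C W Z" "h \<cdot> a = 0"
  obtains b where "b \<in> Hom C W Y" "g \<cdot> b = a"
  using dist_lift[OF rotate[OF T] assms(2-)] .

lemma dist_lift3:
  assumes T: "(X, Y, Z, f, g, h) \<in> Dist C" and W: "W \<in> Obj C" and a: "a \<in> Hom C W (Sh C X)" "sh C f \<cdot> a = 0"
  obtains b where "b \<in> Hom C W Z" "h \<cdot> b = a"
proof -
  note t = DistD[OF T]
  have "- sh C f \<cdot> a = - (sh C f \<cdot> a)"
    using t W by (intro comp_uminus_left[OF a(1) sh_hom[OF t(1,2,4)]]) simp_all
  then have "- sh C f \<cdot> a = 0"
    using a(2) by simp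
  then show ?thesis
    using dist_lift2[OF rotate[OF T] W a(1)] that by blast
qed

lemma dist_extend2:
  assumes T: "(X, Y, Z, f, g, h) \<in> Dist C" and W: "W \<in> Obj C" and a: "a \<in> Hom C Z W" "a \<cdot> g = 0"
  obtains b where "b \<in> Hom C (Sh C X) W" "b \<cdot> h = a"
  using dist_extend[OF rotate[OF T] assms(2-)] .

end

text \<open>In the idempotent completion, the object \<open>N\<close> is the direct sum of \<open>(X, p)\<close> and \<open>(Y, q)\<close>.\<close>

definition splitting ::
  "('o, 'm::ab_group_add, 'z) category_scheme \<Rightarrow> 'o \<Rightarrow> 'm \<Rightarrow> 'o \<Rightarrow> 'm \<Rightarrow> 'o \<Rightarrow> 'm \<Rightarrow> 'm \<Rightarrow> 'm \<Rightarrow> 'm \<Rightarrow> bool" where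
  "splitting C X p Y q N i j r s \<longleftrightarrow>
     X \<in> Obj C \<and> Y \<in> Obj C \<and> N \<in> Obj C \<and>
     i \<in> Hom C X N \<and> j \<in> Hom C Y N \<and> r \<in> Hom C N X \<and> s \<in> Hom C N Y \<and>
     r \<cdot>\<^bsub>C\<^esub> i = p \<and> s \<cdot>\<^bsub>C\<^esub> j = q \<and> r \<cdot>\<^bsub>C\<^esub> j = 0 \<and> s \<cdot>\<^bsub>C\<^esub> i = 0 \<and>
     i \<cdot>\<^bsub>C\<^esub> r + j \<cdot>\<^bsub>C\<^esub> s = ident C N"

section \<open>Decompositions in the idempotent completion and cones\<close>

context additive_category
begin

lemma splitting_swap: "splitting C X p Y q N i j r s \<Longrightarrow> splitting C Y q X p N j i s r"
  by (auto simp: splitting_def add.commute)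

lemma splittingD:
  assumes "splitting C X p Y q N i j r s"
  shows "X \<in> Obj C" "Y \<in> Obj C" "N \<in> Obj C"
    "i \<in> Hom C X N" "j \<in> Hom C Y N" "r \<in> Hom C N X" "s \<in> Hom C N Y"
    "p \<in> Hom C X X" "q \<in> Hom C Y Y"
    "r \<cdot> i = p" "s \<cdot> j = q" "r \<cdot> j = 0" "s \<cdot> i = 0" "i \<cdot> r + j \<cdot> s = ident C N"
    "i \<cdot> r = ident C N - j \<cdot> s"
  using assms by (auto simp: splitting_def comp_hom eq_diff_eq)

text \<open>Composing the decomposition of \<open>ident C N\<close> with \<open>r\<close> and with
  \<open>i\<close> gives the first two equations. Hence \<open>i\<close> and \<open>r\<close> are
  morphisms between \<open>(X, p)\<close> and \<open>N\<close> in the completion, and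
  \<open>p\<close> is idempotent.\<close>

lemma splitting_idem:
  assumes "splitting C X p Y q N i j r s"
  shows "p \<cdot> r = r" "i \<cdot> p = i" "p \<cdot> p = p"
proof -
  note D = splittingD[OF assms]
  note eqs = opr_eqs[OF D(6,5,12)] opr_eqs[OF D(7,4,13)] 
  have 1: "opr N N (i \<cdot> r) = opr N N (ident C N - j \<cdot> s)"
    by (simp only: D(15))
  have "opr N X ((r \<cdot> i) \<cdot> r) = opr N X r"
    using 1 D(1-9) by (simp add: opr_simps eqs)
  then show pr: "p \<cdot> r = r"
    using D(1-9) by (intro opr_eqI[of N X]) (simp_all add: hom_simps D(10))
  have "opr X N (i \<cdot> (r \<cdot> i)) = opr X N i"
    using arg_cong[OF 1, of "\<lambda>F. F \<circ> opr X N i"] D(1-9) by (simp add: opr_simps eqs)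
  then show "i \<cdot> p = i"
    using D(1-9) by (intro opr_eqI[of X N]) (simp_all add: hom_simps D(10))
  show "p \<cdot> p = p"
    using comp_assoc[OF D(1,3,1,1,4,6,8)] pr D(10) by simp
qed

end

context triangulated_category
begin

lemma splitting_Sh:
  assumes "splitting C X p Y q N i j r s"
  shows "splitting C (Sh C X) (sh C p) (Sh C Y) (sh C q) (Sh C N) (sh C i) (sh C j) (sh C r) (sh C s)"
proof -
  note D = splittingD[OF assms]
  have "sh C i \<cdot> sh C r + sh C j \<cdot> sh C s = sh C (i \<cdot> r + j \<cdot> s)"
    using D(1-9) by (simp add: sh_add[of N N] comp_homI sh_comp[OF D(3,1,3,6,4)] sh_comp[OF D(3,2,3,7,5)])
  also have "\<dots> = ident C (Sh C N)"
    by (simp only: D(14) sh_ident[OF D(3)])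
  finally show ?thesis
    using sh_comp[OF D(1,3,1,4,6)] sh_comp[OF D(2,3,2,5,7)] sh_comp[OF D(2,3,1,5,6)] sh_comp[OF D(1,3,2,4,7)]
      D(1-13) by (simp add: splitting_def sh_hom)
qed

text \<open>The cone of a morphism \<open>A \<oplus> B \<rightarrow> D \<oplus> B\<close> which is the identity on \<open>B\<close> and zero on \<open>A\<close>.\<close>

lemma cone_splitting:
  assumes A: "splitting C A a B b P iA iB rA rB"
    and D: "splitting C D d B b N iD jB rD sB"
    and T: "(P, N, Z, jB \<cdot> rB, u, v) \<in> Dist C"
  obtains i j r s where "splitting C D d (Sh C A) (sh C a) Z i j r s"
proof -
  note A1 = splittingD[OF A] and D1 = splittingD[OF D] and T1 = DistD[OF T]
  note A2 = splittingD[OF splitting_Sh[OF A]]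
  note D2 = splittingD[OF splitting_Sh[OF D]]
  note idem = splitting_idem[OF D] splitting_idem[OF splitting_swap[OF D]]
    splitting_idem[OF splitting_swap[OF A]] splitting_idem[OF splitting_Sh[OF A]]
    splitting_idem[OF splitting_swap[OF splitting_Sh[OF A]]]
  note t = A1(1-9) D1(1-9) T1 A2(1-9)
  note vu = dist_comp_zero2[OF T]
  \<comment> \<open>The projection of \<open>N\<close> to \<open>(D, d)\<close> kills the map whose
    cone is \<open>Z\<close>, so it extends along \<open>u\<close> to \<open>Z\<close>.\<close>
  have "rD \<cdot> (jB \<cdot> rB) = 0"
    using t by (intro opr_eqI[of P D]) (simp_all add: opr_simps opr_eqs[OF D1(6,5,12)])
  from dist_extend[OF T D1(1) D1(6) this]
  obtain \<sigma> where \<sigma>: "\<sigma> \<in> Hom C Z D" "\<sigma> \<cdot> u = rD" .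
  \<comment> \<open>Composing with \<open>d\<close> turns the extension into a morphism to
    \<open>(D, d)\<close> and does not change its composite with \<open>u\<close>.\<close>
  define r where "r = d \<cdot> \<sigma>"
  have r: "r \<in> Hom C Z D"
    using \<sigma> t by (simp add: r_def hom_simps)
  have ru: "r \<cdot> u = rD"
    using t \<sigma>(1) by (intro opr_eqI[of N D])
      (simp_all add: r_def opr_simps opr_eqs[OF \<sigma>(1) T1(5) \<sigma>(2)] opr_eqs[OF D1(8,6) idem(1)])
  have dr: "d \<cdot> r = r"
    using t \<sigma>(1) by (intro opr_eqI[of Z D])
      (simp_all add: r_def opr_simps opr_eqs[OF D1(8,8) idem(3)])
  have sh\<phi>: "sh C (jB \<cdot> rB) = sh C jB \<cdot> sh C rB" "sh C jB \<in> Hom C (Sh C B) (Sh C N)"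
    using sh_comp[OF A1(3,2) D1(3) A1(7) D1(5)] sh_hom[OF D1(2,3,5)] by auto
  \<comment> \<open>Dually, the shifted inclusion of \<open>(A, a)\<close> is killed by the shifted
    map, so it lifts along \<open>v\<close> to \<open>Z\<close>.\<close>
  have "sh C (jB \<cdot> rB) \<cdot> sh C iA = 0"
    using t sh\<phi>(2) unfolding sh\<phi>(1)
    by (intro opr_eqI[of "Sh C A" "Sh C N"]) (simp_all add: opr_simps opr_eqs[OF A2(7,4,13)])
  from dist_lift3[OF T A2(1,4) this]
  obtain \<tau> where \<tau>: "\<tau> \<in> Hom C (Sh C A) Z" "v \<cdot> \<tau> = sh C iA" .
  define i where "i = u \<cdot> iD"
  \<comment> \<open>The correction term makes the composite with \<open>r\<close> vanish; since
    \<open>v \<cdot> i = 0\<close>, the map is still a lift of \<open>sh C iA\<close>.\<close>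
  define j where "j = \<tau> - i \<cdot> (r \<cdot> \<tau>)"
  define s where "s = sh C rA \<cdot> v"
  have ijs: "i \<in> Hom C D Z" "j \<in> Hom C (Sh C A) Z" "s \<in> Hom C Z (Sh C A)"
  proof -
    show i: "i \<in> Hom C D Z"
      using t by (simp add: i_def hom_simps)
    show "j \<in> Hom C (Sh C A) Z" "s \<in> Hom C Z (Sh C A)"
      using t i r \<tau>(1) by (simp_all add: j_def s_def hom_simps)
  qed
  have ri: "r \<cdot> i = d"
    using t r by (intro opr_eqI[of D D])
      (simp_all add: i_def opr_simps opr_eqs[OF r T1(5) ru] opr_eqs[OF D1(6,4,10)])
  have vi: "v \<cdot> i = 0"
    using t by (intro opr_eqI[of D "Sh C P"])
      (simp_all add: i_def opr_simps opr_eqs[OF T1(6,5) vu])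
  have vj: "v \<cdot> j = sh C iA"
    using t r ijs \<tau>(1) by (intro opr_eqI[of "Sh C A" "Sh C P"])
      (simp_all add: j_def opr_simps opr_eqs[OF T1(6) ijs(1) vi] opr_eqs[OF T1(6) \<tau>])
  have rj: "r \<cdot> j = 0"
    using t r ijs \<tau>(1) by (intro opr_eqI[of "Sh C A" D])
      (simp_all add: j_def opr_simps opr_eqs[OF r ijs(1) ri] opr_eqs[OF D1(8) r dr])
  have sj: "s \<cdot> j = sh C a"
    using t r ijs by (intro opr_eqI[of "Sh C A" "Sh C A"])
      (simp_all add: s_def opr_simps opr_eqs[OF T1(6) ijs(2) vj] opr_eqs[OF A2(6,4,10)])
  have si: "s \<cdot> i = 0"
    using t r ijs by (intro opr_eqI[of D "Sh C A"])
      (simp_all add: s_def opr_simps opr_eqs[OF T1(6) ijs(1) vi])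
  have as: "sh C a \<cdot> s = s"
    using t by (intro opr_eqI[of Z "Sh C A"])
      (simp_all add: s_def opr_simps opr_eqs[OF A2(8,6) idem(10)])
  \<comment> \<open>\<open>R\<close> is the defect of the desired decomposition. Since
    \<open>R \<cdot> u = 0\<close>, it factors through \<open>v\<close>; together with
    \<open>v \<cdot> R = 0\<close> this gives \<open>R \<cdot> R = 0\<close>. As \<open>R\<close> is
    also idempotent, it is 0.\<close>
  define R where "R = ident C Z - i \<cdot> r - j \<cdot> s"
  have R: "R \<in> Hom C Z Z"
    using t ijs r by (simp add: R_def hom_simps)
  have oR: "opr Z Z R = opr Z Z (ident C Z) - (opr D Z i \<circ> opr Z D r) - (opr (Sh C A) Z j \<circ> opr Z (Sh C A) s)"
    using t ijs r by (simp add: R_def opr_simps)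
  have "R \<cdot> u = u - i \<cdot> (r \<cdot> u) - j \<cdot> (sh C rA \<cdot> (v \<cdot> u))"
    using t r ijs by (intro opr_eqI[of N Z]) (simp_all add: R_def s_def opr_simps)
  also have "\<dots> = u \<cdot> (ident C N - iD \<cdot> rD)"
    unfolding ru vu using t ijs by (intro opr_eqI[of N Z]) (simp_all add: i_def opr_simps)
  also have "ident C N - iD \<cdot> rD = jB \<cdot> sB"
    using splittingD(15)[OF splitting_swap[OF D]] by simp
  \<comment> \<open>The relations \<open>rB \<cdot> iB = b\<close> and
    \<open>b \<cdot> sB = sB\<close> insert the first map of the triangle, which \<open>u\<close>
    kills.\<close>
  also have "u \<cdot> (jB \<cdot> sB) = (u \<cdot> (jB \<cdot> rB)) \<cdot> (iB \<cdot> sB)"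
    using t by (intro opr_eqI[of N Z])
      (simp_all add: opr_simps opr_comp[where g = "_ \<cdot> _" and Y = P]
        comp_homI[where g = "_ \<cdot> _" and Y = P] opr_eqs[OF A1(7,5,11)] opr_eqs[OF D1(9,7) idem(4)])
  also have "\<dots> = 0"
    using t dist_comp_zero[OF T] comp_zero_left[of N P Z] by (simp add: hom_simps)
  finally have Ru: "R \<cdot> u = 0" .
  \<comment> \<open>Similarly, \<open>sB \<cdot> jB = b\<close> and \<open>b \<cdot> rB = rB\<close>
    insert the shifted first map, which kills \<open>v\<close>.\<close>
  have "sh C rB \<cdot> v = sh C sB \<cdot> (sh C (jB \<cdot> rB) \<cdot> v)"
    unfolding sh\<phi>(1) using t D2(1-9) by (intro opr_eqI[of Z "Sh C B"])
      (simp_all add: opr_simps hom_simps opr_eqs[OF D2(7,5,11)] opr_eqs[OF A2(9,7) idem(13)])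
  also have "\<dots> = 0"
    using t dist_comp_zero3[OF T] comp_zero_right[OF _ _ _ D2(7)] by simp
  finally have rBv: "sh C rB \<cdot> v = 0" .
  have "v \<cdot> R = v - sh C iA \<cdot> (sh C rA \<cdot> v)"
    using t r ijs by (intro opr_eqI[of Z "Sh C P"]) (simp_all add: R_def opr_simps hom_simps
      opr_eqs[OF T1(6) ijs(1) vi] opr_eqs[OF T1(6) ijs(2) vj] s_def)
  also have "\<dots> = (ident C (Sh C P) - sh C iA \<cdot> sh C rA) \<cdot> v"
    using t by (intro opr_eqI[of Z "Sh C P"]) (simp_all add: opr_simps hom_simps)
  also have "ident C (Sh C P) - sh C iA \<cdot> sh C rA = sh C iB \<cdot> sh C rB"
    using splittingD(15)[OF splitting_swap[OF splitting_Sh[OF A]]] by simp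
  also have "(sh C iB \<cdot> sh C rB) \<cdot> v = sh C iB \<cdot> (sh C rB \<cdot> v)"
    using t by (intro opr_eqI[of Z "Sh C P"]) (simp_all add: opr_simps hom_simps)
  also have "\<dots> = 0"
    unfolding rBv using t comp_zero_right[OF _ _ _ A2(5)] by blast
  finally have vR: "v \<cdot> R = 0" .
  obtain R' where R': "R' \<in> Hom C (Sh C P) Z" "R' \<cdot> v = R"
    using dist_extend2[OF T T1(3) R Ru] .
  have "R \<cdot> R = R' \<cdot> (v \<cdot> R)"
    using comp_assoc[OF _ _ _ _ R T1(6) R'(1)] t R'(2) by simp
  also have "\<dots> = 0"
    using vR t R' comp_zero_right[OF _ _ _ R'(1)] by simp
  finally have "R \<cdot> R = 0" .
  moreover have "R \<cdot> R = R"
    using t ijs r R by (intro opr_eqI[of Z Z]) (simp_all add: oR opr_simps opr_eqs[OF r ijs(1) ri]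
      opr_eqs[OF r ijs(2) rj] opr_eqs[OF ijs(3) ijs(1) si] opr_eqs[OF ijs(3) ijs(2) sj] opr_eqs[OF A2(8) ijs(3) as]
      opr_eqs[OF D1(8) r dr])
  ultimately have "i \<cdot> r + j \<cdot> s = ident C Z"
    by (simp add: R_def algebra_simps)
  then have "splitting C D d (Sh C A) (sh C a) Z i j r s"
    using t r ijs ri rj si sj by (simp add: splitting_def)
  then show ?thesis by (rule that)
qed

end

section \<open>Triangles in the idempotent completion\<close>

lemma idem_completion_Obj [simp]:
  "(X, p) \<in> Obj (idem_completion A) \<longleftrightarrow> X \<in> Obj A \<and> p \<in> Hom A X X \<and> p \<cdot>\<^bsub>A\<^esub> p = p"
  by (simp add: idem_completion_def)

lemma idem_completion_Hom [simp]:
  "f \<in> Hom (idem_completion A) (X, p) (Y, q) \<longleftrightarrow>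
     f \<in> Hom A X Y \<and> q \<cdot>\<^bsub>A\<^esub> f = f \<and> f \<cdot>\<^bsub>A\<^esub> p = f"
  by (simp add: idem_completion_def)

lemma idem_completion_simps [simp]:
  "ident (idem_completion A) = snd" "Comp (idem_completion A) = Comp A"
  by (simp_all add: idem_completion_def)

lemma idem_shift_completion_simps [simp]:
  "Obj (idem_shift_completion C) = Obj (idem_completion C)"
  "Hom (idem_shift_completion C) = Hom (idem_completion C)"
  "ident (idem_shift_completion C) = snd"
  "Comp (idem_shift_completion C) = Comp C"
  "Sh (idem_shift_completion C) (X, p) = (Sh C X, sh C p)"
  "sh (idem_shift_completion C) = sh C"
  by (simp_all add: idem_shift_completion_def)

lemma idem_tri_completion_simps [simp]:
  "Obj (idem_tri_completion C) = Obj (idem_completion C)"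
  "Hom (idem_tri_completion C) = Hom (idem_completion C)"
  "ident (idem_tri_completion C) = snd"
  "Comp (idem_tri_completion C) = Comp C"
  "Sh (idem_tri_completion C) (X, p) = (Sh C X, sh C p)"
  "sh (idem_tri_completion C) = sh C"
  by (simp_all add: idem_tri_completion_def)

section \<open>Splitting by idempotents and diagonal maps\<close>

context additive_category
begin

lemma splitting_biproduct:
  assumes S: "splitting C X p Y q N i j r s"
  shows "is_biproduct (idem_completion C) (X, p) (Y, q) (N, ident C N) i j r s"
  using splittingD[OF S] splitting_idem[OF S] splitting_idem[OF splitting_swap[OF S]]
  by (simp add: is_biproduct_def comp_ident_left comp_ident_right ident_hom)

lemma splitting_idempotent:
  assumes "X \<in> Obj C" "e \<in> Hom C X X" "e \<cdot> e = e"
  shows "splitting C X e X (ident C X - e) X e (ident C X - e) e (ident C X - e)"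
proof -
  define e' where "e' = ident C X - e"
  have e': "e' \<in> Hom C X X"
    using assms by (simp add: e'_def hom_simps)
  have o: "opr X X e' = opr X X (ident C X) - opr X X e"
    using assms by (simp add: e'_def opr_simps)
  note eq = opr_eqs[OF assms(2,2,3,1,1,1)]
  have 1: "e \<cdot> e' = 0"
    using assms e' by (intro opr_eqI[of X X]) (simp_all add: opr_simps o eq)
  have 2: "e' \<cdot> e = 0"
    using assms e' by (intro opr_eqI[of X X]) (simp_all add: opr_simps o eq)
  have 3: "e' \<cdot> e' = e'"
    using assms e' by (intro opr_eqI[of X X]) (simp_all add: opr_simps o eq)
  have "splitting C X e X e' X e e' e e'"
    using assms e' 1 2 3 by (simp add: splitting_def) (simp add: e'_def)
  then show ?thesis
    by (simp add: e'_def)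
qed

text \<open>The complement \<open>(X, 0)\<close> is zero in the completion. In this form a vertex
  from \<open>C\<close> enters a decomposed triangle undivided.\<close>

lemma splitting_trivial:
  assumes "X \<in> Obj C"
  shows "splitting C X (ident C X) X 0 X (ident C X) 0 (ident C X) 0"
  using assms splitting_idempotent[of X "ident C X"] by (simp add: ident_hom comp_ident_left)

text \<open>With respect to two decompositions the morphism \<open>f\<close> is a diagonal matrix.\<close>

definition diagonal :: "'m \<Rightarrow> 'm \<Rightarrow> 'm \<Rightarrow> 'm \<Rightarrow> 'm \<Rightarrow> bool" where
  "diagonal f i j r s \<longleftrightarrow> s \<cdot> (f \<cdot> i) = 0 \<and> r \<cdot> (f \<cdot> j) = 0"

lemma diagonal_swap: "diagonal f i j r s \<Longrightarrow> diagonal f j i s r"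
  by (simp add: diagonal_def)

text \<open>The off-diagonal entries vanish, so inserting
  \<open>i' \<cdot> r' = 1 - j' \<cdot> s'\<close> or \<open>i \<cdot> r = 1 - j \<cdot> s\<close>
  changes nothing. The last two equations are the commuting squares demanded by
  \<open>triangle_mor\<close>.\<close>

lemma diagonal_restrict:
  assumes S: "splitting C A a A' a' X i j r s" and S': "splitting C B b B' b' Y i' j' r' s'"
    and f: "f \<in> Hom C X Y" "diagonal f i j r' s'"
  shows "r' \<cdot> (f \<cdot> i) \<in> Hom C A B" "b \<cdot> (r' \<cdot> (f \<cdot> i)) = r' \<cdot> (f \<cdot> i)"
    "(r' \<cdot> (f \<cdot> i)) \<cdot> a = r' \<cdot> (f \<cdot> i)"
    "i' \<cdot> (r' \<cdot> (f \<cdot> i)) = f \<cdot> i" "(r' \<cdot> (f \<cdot> i)) \<cdot> r = r' \<cdot> f"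
proof -
  note D = splittingD[OF S] and D' = splittingD[OF S']
  note t = D(1-9) D'(1-9) f(1)
  note idem = splitting_idem[OF S] splitting_idem[OF S']
  have d: "s' \<cdot> (f \<cdot> i) = 0" "r' \<cdot> (f \<cdot> j) = 0"
    using f(2) by (auto simp: diagonal_def)
  show "r' \<cdot> (f \<cdot> i) \<in> Hom C A B"
    using t by (simp add: hom_simps)
  show "b \<cdot> (r' \<cdot> (f \<cdot> i)) = r' \<cdot> (f \<cdot> i)"
    using t by (intro opr_eqI[of A B]) (simp_all add: opr_simps opr_eqs[OF D'(8,6) idem(4)])
  show "(r' \<cdot> (f \<cdot> i)) \<cdot> a = r' \<cdot> (f \<cdot> i)"
    using t by (intro opr_eqI[of A B]) (simp_all add: opr_simps opr_eqs[OF D(4,8) idem(2)])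
  have "i' \<cdot> (r' \<cdot> (f \<cdot> i)) = (i' \<cdot> r') \<cdot> (f \<cdot> i)"
    using t by (intro opr_eqI[of A Y]) (simp_all add: opr_simps opr_comp[where g = "_ \<cdot> _" and Y = Y]
        comp_homI[where g = "_ \<cdot> _" and Y = Y])
  also have "\<dots> = f \<cdot> i - j' \<cdot> (s' \<cdot> (f \<cdot> i))"
    unfolding D'(15)
    using t by (intro opr_eqI[of A Y]) (simp_all add: opr_simps opr_comp[where g = "_ - _" and Y = Y]
        comp_homI[where g = "_ - _" and Y = Y])
  finally show "i' \<cdot> (r' \<cdot> (f \<cdot> i)) = f \<cdot> i"
    using d t comp_zero_right[of A B' Y j'] by simp
  have "(r' \<cdot> (f \<cdot> i)) \<cdot> r = (r' \<cdot> f) \<cdot> (i \<cdot> r)"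
    using t by (intro opr_eqI[of X B]) (simp_all add: opr_simps opr_comp[where g = "_ \<cdot> _" and Y = X]
        comp_homI[where g = "_ \<cdot> _" and Y = X])
  also have "\<dots> = r' \<cdot> f - (r' \<cdot> (f \<cdot> j)) \<cdot> s"
    unfolding D(15)
    using t by (intro opr_eqI[of X B]) (simp_all add: opr_simps opr_comp[where g = "_ \<cdot> _" and Y = X]
        comp_homI[where g = "_ \<cdot> _" and Y = X])
  finally show "(r' \<cdot> (f \<cdot> i)) \<cdot> r = r' \<cdot> f"
    using d t comp_zero_left[of X A' B s] by simp
qed

end

context triangulated_category
begin

lemma ex_splitting_Sh:
  assumes "X \<in> Obj C" "p \<in> Hom C X X" "p \<cdot> p = p"
  obtains N i j r s where "splitting C X p (Sh C X) (sh C p) N i j r s"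
proof -
  note S = splitting_idempotent[OF assms]
  \<comment> \<open>In the form expected by \<open>cone_splitting\<close> the map is an inclusion
    after a projection; for the summand \<open>(X, 1 - p)\<close> of \<open>X\<close> both are
    \<open>1 - p\<close>.\<close>
  obtain N u v where "(X, X, N, (ident C X - p) \<cdot> (ident C X - p), u, v) \<in> Dist C"
    using TR1_cone[OF assms(1,1)] comp_homI minus_hom ident_hom assms by metis
  from cone_splitting[OF S S this] show ?thesis
    using that .
qed

lemma ex_splitting_odd_Sh:
  assumes "X \<in> Obj C" "p \<in> Hom C X X" "p \<cdot> p = p"
  shows "\<exists>N i j r s. splitting C X p ((Sh C ^^ (2 * n + 1)) X) ((sh C ^^ (2 * n + 1)) p) N i j r s"
proof (induction n)
  case 0
  then show ?case
    using ex_splitting_Sh[OF assms] by (simp, metis)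
next
  case (Suc n)
  define Y q where "Y = (Sh C ^^ (2 * n + 1)) X" and "q = (sh C ^^ (2 * n + 1)) p"
  obtain N i j r s where S: "splitting C X p Y q N i j r s"
    using Suc by (auto simp: Y_def q_def)
  obtain Q i' j' r' s' where S': "splitting C Y q (Sh C Y) (sh C q) Q i' j' r' s'"
    using ex_splitting_Sh[of Y q] splittingD[OF S] splitting_idem[OF splitting_swap[OF S]] by metis
  \<comment> \<open>The map projects \<open>Q\<close> onto its summand \<open>(Y, q)\<close> and
    includes that into \<open>N\<close>. In the cone the two copies of \<open>(Y, q)\<close> cancel,
    leaving \<open>(X, p)\<close> and the shift of the other summand of \<open>Q\<close>.\<close>
  have "j \<cdot> r' \<in> Hom C Q N"
    using splittingD[OF S] splittingD[OF S'] by (metis comp_homI)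
  then obtain Z u v where "(Q, N, Z, j \<cdot> r', u, v) \<in> Dist C"
    using TR1_cone splittingD[OF S] splittingD[OF S'] by metis
  from cone_splitting[OF splitting_swap[OF S'] S this]
  obtain i'' j'' r'' s'' where "splitting C X p (Sh C (Sh C Y)) (sh C (sh C q)) Z i'' j'' r'' s''" .
  moreover have "Sh C (Sh C Y) = (Sh C ^^ (2 * Suc n + 1)) X" "sh C (sh C q) = (sh C ^^ (2 * Suc n + 1)) p"
    by (simp_all add: Y_def q_def)
  ultimately show ?case
    by metis
qed

text \<open>Three diagonal maps make the triangle the biproduct of its restrictions to the first and
  to the second summands, so the first restriction is a direct summand of a triangle of
  \<open>C\<close>. All distinguished triangles constructed below arise this way.\<close>

lemma dist_idem_completionI:
  assumes T: "(X1, X2, X3, f, g, h) \<in> Dist C"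
    and S1: "splitting C A1 a1 A1' a1' X1 i1 j1 r1 s1"
    and S2: "splitting C A2 a2 A2' a2' X2 i2 j2 r2 s2"
    and S3: "splitting C A3 a3 A3' a3' X3 i3 j3 r3 s3"
    and f: "diagonal f i1 j1 r2 s2" and g: "diagonal g i2 j2 r3 s3"
    and h: "diagonal h i3 j3 (sh C r1) (sh C s1)"
  shows "((A1, a1), (A2, a2), (A3, a3), r2 \<cdot> (f \<cdot> i1), r3 \<cdot> (g \<cdot> i2), sh C r1 \<cdot> (h \<cdot> i3))
    \<in> Dist (idem_tri_completion C)"
proof -
  note t = DistD[OF T]
  note D = splittingD[OF S1] splittingD[OF S2] splittingD[OF S3]
  note bip = splitting_biproduct[OF S1] splitting_biproduct[OF S2] splitting_biproduct[OF S3]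
  note S4 = splitting_Sh[OF S1]
  note R = diagonal_restrict[OF S1 S2 t(4) f] diagonal_restrict[OF S2 S3 t(5) g]
    diagonal_restrict[OF S3 S4 t(6) h]
  note S1' = splitting_swap[OF S1] and S2' = splitting_swap[OF S2] and S3' = splitting_swap[OF S3]
  note S4' = splitting_Sh[OF S1']
  note R' = diagonal_restrict[OF S1' S2' t(4) diagonal_swap[OF f]]
    diagonal_restrict[OF S2' S3' t(5) diagonal_swap[OF g]]
    diagonal_restrict[OF S3' S4' t(6) diagonal_swap[OF h]]
  note I = splitting_idem[OF S1] splitting_idem[OF S2] splitting_idem[OF S3]
    splitting_idem[OF S1'] splitting_idem[OF S2'] splitting_idem[OF S3']
    splitting_idem[OF S4] splitting_idem[OF S4']
  let ?E = "idem_embedding_triangle C (X1, X2, X3, f, g, h)"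
  let ?S = "((A1, a1), (A2, a2), (A3, a3), r2 \<cdot> (f \<cdot> i1), r3 \<cdot> (g \<cdot> i2), sh C r1 \<cdot> (h \<cdot> i3))"
  let ?S' = "((A1', a1'), (A2', a2'), (A3', a3'), s2 \<cdot> (f \<cdot> j1), s3 \<cdot> (g \<cdot> j2), sh C s1 \<cdot> (h \<cdot> j3))"
  have "is_triangle (idem_shift_completion C) ?S" "is_triangle (idem_shift_completion C) ?S'"
    using D R R' I by simp_all
  moreover have "triangle_biproduct (idem_shift_completion C) ?S ?S' ?E (i1, i2, i3) (j1, j2, j3) (r1, r2, r3) (s1, s2, s3)"
    using bip R(4,5,9,10,14,15) R'(4,5,9,10,14,15) 
    by (simp add: idem_embedding_def is_biproduct_def)
  ultimately show ?thesis
    using T unfolding idem_tri_completion_def triangle_summand_def by (simp only: tri_category.simps) blast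
qed

text \<open>Supplies the diagonality of the maps \<open>- sh C f\<close> that rotation
  produces.\<close>

lemma diagonal_uminus_Sh:
  assumes S1: "splitting C A1 a1 A1' a1' X1 i1 j1 r1 s1"
    and S2: "splitting C A2 a2 A2' a2' X2 i2 j2 r2 s2"
    and f: "f \<in> Hom C X1 X2" "diagonal f i1 j1 r2 s2"
  shows "diagonal (- sh C f) (sh C i1) (sh C j1) (sh C r2) (sh C s2)"
proof -
  have *: "sh C r \<cdot> (- sh C f \<cdot> sh C i) = 0"
    if "A \<in> Obj C" "B \<in> Obj C" "X1 \<in> Obj C" "X2 \<in> Obj C" "r \<in> Hom C X2 B" "i \<in> Hom C A X1" "r \<cdot> (f \<cdot> i) = 0" for r i A B
  proof -
    note sh = sh_hom[OF that(4,2,5)] sh_hom[OF that(1,3,6)] sh_hom[OF that(3,4) f(1)]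
    have "sh C r \<cdot> (- sh C f \<cdot> sh C i) = - (sh C r \<cdot> (sh C f \<cdot> sh C i))"
      using sh that by (intro opr_eqI[of "Sh C A" "Sh C B"]) (simp_all add: opr_simps)
    also have "sh C r \<cdot> (sh C f \<cdot> sh C i) = sh C (r \<cdot> (f \<cdot> i))"
      using sh_comp[OF that(1,3,4,6) f(1)] sh_comp[OF that(1,4,2) comp_homI[OF f(1) that(6,1,3,4)] that(5)]
      by simp
    finally show ?thesis
      using that by simp
  qed
  note D = splittingD[OF S1] splittingD[OF S2]
  show ?thesis
    using f(2) *[OF D(1,17,3,18,22,4)] *[OF D(2,16,3,18,21,5)] by (simp add: diagonal_def)
qed

end

section \<open>Weight structures\<close>

lemma shift_by_one [simp]: "shift_by C 1 = Sh C"
  by (simp add: shift_by_def fun_eq_iff)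

lemma shift_by_minus_one: "shift_by C (-1) = inv_into (Obj C) (Sh C)"
  by (simp add: shift_by_def fun_eq_iff)

lemma shift_by_of_nat: "shift_by C (int n) = Sh C ^^ n"
  by (simp add: shift_by_def fun_eq_iff)

lemma shift_by_minus_of_nat: "shift_by C (- int n) = inv_into (Obj C) (Sh C) ^^ n"
  by (cases "n = 0") (simp_all add: shift_by_def fun_eq_iff)

lemma funpow_closed:
  assumes "\<And>x. x \<in> S \<Longrightarrow> f x \<in> S" "x \<in> S"
  shows "(f ^^ n) x \<in> S"
  using assms by (induction n) auto

lemma inv_into_funpow:
  assumes "bij_betw f A A" "x \<in> A"
  shows "(inv_into A f ^^ n) ((f ^^ n) x) = x" "(f ^^ n) ((inv_into A f ^^ n) x) = x"
proof -
  have f: "f y \<in> A" "inv_into A f (f y) = y" if "y \<in> A" for y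
    using assms that by (auto simp: bij_betw_def inv_into_f_f)
  have g: "inv_into A f y \<in> A" "f (inv_into A f y) = y" if "y \<in> A" for y
    using assms that by (auto simp: bij_betw_def f_inv_into_f inv_into_into)
  show "(inv_into A f ^^ n) ((f ^^ n) x) = x"
  proof (induction n)
    case (Suc n)
    have "inv_into A f (f ((f ^^ n) x)) = (f ^^ n) x"
      using f assms(2) by (simp add: funpow_closed[of A f])
    then show ?case
      using Suc by (simp add: funpow_swap1)
  qed simp
  show "(f ^^ n) ((inv_into A f ^^ n) x) = x"
  proof (induction n)
    case (Suc n)
    have "f (inv_into A f ((inv_into A f ^^ n) x)) = (inv_into A f ^^ n) x"
      using g assms(2) by (simp add: funpow_closed[of A "inv_into A f"])
    then show ?case
      using Suc by (simp add: funpow_swap1)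
  qed simp
qed

lemma shift_by_Obj:
  assumes "bij_betw (Sh C) (Obj C) (Obj C)" "X \<in> Obj C"
  shows "shift_by C n X \<in> Obj C"
proof -
  have "Sh C Y \<in> Obj C" "inv_into (Obj C) (Sh C) Y \<in> Obj C" if "Y \<in> Obj C" for Y
    using assms that by (auto simp: bij_betw_def inv_into_into)
  then show ?thesis
    unfolding shift_by_def using assms(2) by (auto intro!: funpow_closed)
qed

text \<open>Boundedness is reduced to natural iterates of the shift: for the class of nonpositive
  weights an object is shifted into the class, for the other one (\<open>bounded_geI\<close>) it is
  written as a shift of a member.\<close>

lemma bounded_leI:
  assumes "bij_betw (Sh C) (Obj C) (Obj C)" "S \<subseteq> Obj C"
    and "\<And>X. X \<in> Obj C \<Longrightarrow> \<exists>n. (Sh C ^^ n) X \<in> S"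
  shows "(\<Union>l::int. shift_by C (- l) ` S) = Obj C"
proof
  show "(\<Union>l::int. shift_by C (- l) ` S) \<subseteq> Obj C"
    using shift_by_Obj[OF assms(1)] assms(2) by blast
  show "Obj C \<subseteq> (\<Union>l::int. shift_by C (- l) ` S)"
  proof
    fix X assume X: "X \<in> Obj C"
    then obtain n where n: "(Sh C ^^ n) X \<in> S"
      using assms(3) by blast
    have "X = shift_by C (- int n) ((Sh C ^^ n) X)"
      using inv_into_funpow[OF assms(1) X] by (simp add: shift_by_minus_of_nat)
    then show "X \<in> (\<Union>l::int. shift_by C (- l) ` S)"
      using n by blast
  qed
qed

lemma bounded_geI:
  assumes "bij_betw (Sh C) (Obj C) (Obj C)" "S \<subseteq> Obj C"
    and "\<And>X. X \<in> Obj C \<Longrightarrow> \<exists>n. \<exists>Y\<in>S. X = (Sh C ^^ n) Y"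
  shows "(\<Union>l::int. shift_by C (- l) ` S) = Obj C"
proof
  show "(\<Union>l::int. shift_by C (- l) ` S) \<subseteq> Obj C"
    using shift_by_Obj[OF assms(1)] assms(2) by blast
  show "Obj C \<subseteq> (\<Union>l::int. shift_by C (- l) ` S)"
  proof
    fix X assume X: "X \<in> Obj C"
    then obtain n Y where n: "Y \<in> S" "X = (Sh C ^^ n) Y"
      using assms(3) by blast
    then have "X = shift_by C (- (- int n)) Y"
      by (simp add: shift_by_of_nat)
    then show "X \<in> (\<Union>l::int. shift_by C (- l) ` S)"
      using n by blast
  qed
qed

section \<open>Orthogonality, weight decompositions and extensions in \<open>C\<close>\<close>

locale bounded_weight_category = triangulated_category C
  for C :: "('o, 'm::ab_group_add, 'z) tri_category_scheme" (structure) +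
  fixes w_le w_ge :: "'o set"
  assumes bounded_weight: "bounded_weight_structure C w_le w_ge"
begin

lemma weight: "weight_structure C w_le w_ge"
  using bounded_weight by (simp add: bounded_weight_structure_def)

lemma weightD:
  shows "additive_subclass C w_le" "additive_subclass C w_ge"
    "Karoubi_closed C w_le" "Karoubi_closed C w_ge"
    "w_ge \<subseteq> Sh C ` w_ge" "Sh C ` w_le \<subseteq> w_le" "orthogonal C w_ge (Sh C ` w_le)"
  using weight unfolding weight_structure_def shift_by_one by simp_all

lemma w_le_Obj: "X \<in> w_le \<Longrightarrow> X \<in> Obj C" and w_ge_Obj: "X \<in> w_ge \<Longrightarrow> X \<in> Obj C"
  using weightD(1,2) unfolding additive_subclass_def by blast+

lemma w_le_Sh: "X \<in> w_le \<Longrightarrow> Sh C X \<in> w_le"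
  using weightD(6) by blast

lemma Sh_inj: "\<lbrakk>X \<in> Obj C; Y \<in> Obj C; Sh C X = Sh C Y\<rbrakk> \<Longrightarrow> X = Y"
  using Sh_bij by (auto simp: bij_betw_def inj_on_def)

lemma w_ge_unshift:
  assumes "X \<in> Obj C" "Sh C X \<in> w_ge"
  shows "X \<in> w_ge"
proof -
  obtain Y where "Y \<in> w_ge" "Sh C X = Sh C Y"
    using weightD(5) assms by blast
  then show ?thesis
    using Sh_inj[of X Y] assms w_ge_Obj by simp
qed

lemma w_orth: "\<lbrakk>X \<in> w_ge; L \<in> w_le; f \<in> Hom C X (Sh C L)\<rbrakk> \<Longrightarrow> f = 0"
  using weightD(7) unfolding orthogonal_def by blast

text \<open>Orthogonality desuspended once, which is the form that suits the first vertex in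
  \<open>w_decomposition\<close>.\<close>

lemma w_orth_unshift:
  assumes "X \<in> Obj C" "Sh C X \<in> w_ge" "L \<in> w_le" "f \<in> Hom C X L"
  shows "f = 0"
proof -
  have "sh C f = 0"
    using w_orth[OF assms(2,3)] sh_hom[OF _ _ assms(4)] assms w_le_Obj by blast
  then show ?thesis
    using sh_inj[of X L f 0] assms w_le_Obj zero_hom by simp
qed

text \<open>Naming the first vertex itself \<open>B\<close> keeps the inverse shift out of the
  triangle; it is \<open>Sh C B\<close> that lies in \<open>w_ge\<close>.\<close>

lemma w_decomposition:
  assumes "X \<in> Obj C"
  obtains B A f g h where "(B, X, A, f, g, h) \<in> Dist C" "Sh C B \<in> w_ge" "A \<in> w_le"
proof -
  obtain A B' f g h where *: "A \<in> w_le" "B' \<in> w_ge" "(shift_by C (-1) B', X, A, f, g, h) \<in> Dist C"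
    using weight unfolding weight_structure_def by (elim conjE ballE[of _ _ X]) (use assms in auto)
  have "Sh C (shift_by C (-1) B') = B'"
    using Sh_bij w_ge_Obj[OF *(2)] by (simp add: shift_by_minus_one bij_betw_def f_inv_into_f)
  then show ?thesis
    using * that by metis
qed

text \<open>Decompose X[-1] and rotate twice.\<close>

lemma w_decomposition':
  assumes "X \<in> Obj C"
  obtains L B e f g where "(L, B, X, e, f, g) \<in> Dist C" "B \<in> w_ge" "L \<in> w_le"
proof -
  obtain X0 where X0: "X0 \<in> Obj C" "X = Sh C X0"
    using Sh_surj assms by blast
  obtain B A f g h where *: "(B, X0, A, f, g, h) \<in> Dist C" "Sh C B \<in> w_ge" "A \<in> w_le"
    using w_decomposition[OF X0(1)] by blast
  then show ?thesis
    using rotate[OF rotate[OF *(1)]] that X0(2) by blast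
qed

text \<open>In a weight decomposition of \<open>A\<close> the first map vanishes, so the identity of
  \<open>A\<close> extends over \<open>L\<close> and \<open>A\<close> is a retract of
  \<open>L\<close>. Thus \<open>w_le\<close> is a full right orthogonal.\<close>

lemma w_leI:
  assumes A: "A \<in> Obj C" and orth: "\<And>B f. \<lbrakk>B \<in> Obj C; Sh C B \<in> w_ge; f \<in> Hom C B A\<rbrakk> \<Longrightarrow> f = 0"
  shows "A \<in> w_le"
proof -
  obtain B L f g h where T: "(B, A, L, f, g, h) \<in> Dist C" and B: "Sh C B \<in> w_ge" and L: "L \<in> w_le"
    using w_decomposition[OF A] by blast
  note t = DistD[OF T]
  have "f = 0"
    using orth t B by blast
  then have "ident C A \<cdot> f = 0"
    using t ident_hom comp_zero_right by blast
  from dist_extend[OF T A ident_hom[OF A] this]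
  obtain r where "r \<in> Hom C L A" "r \<cdot> g = ident C A" .
  then have "is_retract C A L"
    using t by (auto simp: is_retract_def)
  then show ?thesis
    using weightD(3) L unfolding Karoubi_closed_def by blast
qed

text \<open>Dual to \<open>w_leI\<close>: the map from \<open>A\<close> to L[1] vanishes, so the
  identity of \<open>A\<close> lifts to \<open>B\<close>.\<close>

lemma w_geI:
  assumes A: "A \<in> Obj C" and orth: "\<And>L f. \<lbrakk>L \<in> w_le; f \<in> Hom C A (Sh C L)\<rbrakk> \<Longrightarrow> f = 0"
  shows "A \<in> w_ge"
proof -
  obtain L B e f g where T': "(L, B, A, e, f, g) \<in> Dist C" and B: "B \<in> w_ge" and L: "L \<in> w_le"
    using w_decomposition'[OF A] by blast
  note T = rotate[OF T']
  note t = DistD[OF T]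
  have "g = 0"
    using orth t L by blast
  then have "g \<cdot> ident C A = 0"
    using t ident_hom comp_zero_left by blast
  from dist_lift[OF T A ident_hom[OF A] this]
  obtain r where "r \<in> Hom C A B" "f \<cdot> r = ident C A" .
  then have "is_retract C A B"
    using t by (auto simp: is_retract_def)
  then show ?thesis
    using weightD(4) B unfolding Karoubi_closed_def by blast
qed

text \<open>A right orthogonal is closed under extensions: a map to \<open>B\<close> that dies in
  \<open>A\<close> comes from a map to \<open>L\<close>, which is 0.\<close>

lemma w_le_extension:
  assumes T: "(L, B, A, e, f, g) \<in> Dist C" and "L \<in> w_le" "A \<in> w_le"
  shows "B \<in> w_le"
proof (rule w_leI)
  note t = DistD[OF T]
  show "B \<in> Obj C"
    by (rule t)
  fix Y d assume Y: "Y \<in> Obj C" "Sh C Y \<in> w_ge" and d: "d \<in> Hom C Y B"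
  have "f \<cdot> d = 0"
    using w_orth_unshift[OF Y assms(3)] comp_homI[OF t(5) d Y(1) t(2,3)] by simp
  then obtain c where c: "c \<in> Hom C Y L" "e \<cdot> c = d"
    using dist_lift[OF T Y(1) d] by blast
  then have "c = 0"
    using w_orth_unshift[OF Y assms(2)] by simp
  then show "d = 0"
    using c comp_zero_right[OF Y(1) t(1,2,4)] by simp
qed

lemma w_le_funpow_Sh: "X \<in> w_le \<Longrightarrow> (Sh C ^^ n) X \<in> w_le"
  using w_le_Sh by (rule funpow_closed)

text \<open>The integer given by boundedness may have either sign. If it is negative, the object is
  already in \<open>w_le\<close>, because that class is closed under positive shifts;
  \<open>ex_w_ge_Sh\<close> is dual.\<close>

lemma ex_Sh_w_le:
  assumes "X \<in> Obj C"
  obtains n where "(Sh C ^^ n) X \<in> w_le"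
proof -
  have "X \<in> (\<Union>l::int. shift_by C (- l) ` w_le)"
    using bounded_weight assms by (simp add: bounded_weight_structure_def)
  then obtain l A where A: "A \<in> w_le" "X = shift_by C (- l) A"
    by blast
  show ?thesis
  proof (cases "l \<ge> 0")
    case True
    then obtain n where "l = int n"
      using nonneg_int_cases by blast
    then have "(Sh C ^^ n) X = A"
      using A inv_into_funpow(2)[OF Sh_bij, of A n] w_le_Obj by (simp add: shift_by_minus_of_nat)
    then show ?thesis
      using A that by blast
  next
    case False
    then obtain n where "- l = int n"
      using nonneg_int_cases[of "- l"] by auto
    then have "X \<in> w_le"
      using A w_le_funpow_Sh by (simp add: shift_by_of_nat)
    then show ?thesis
      using that[of 0] by simp
  qed
qed

lemma ex_w_ge_Sh:
  assumes "X \<in> Obj C"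
  obtains n Y where "Y \<in> w_ge" "X = (Sh C ^^ n) Y"
proof -
  have "X \<in> (\<Union>l::int. shift_by C (- l) ` w_ge)"
    using bounded_weight assms by (simp add: bounded_weight_structure_def)
  then obtain l B where B: "B \<in> w_ge" "X = shift_by C (- l) B"
    by blast
  show ?thesis
  proof (cases "l \<ge> 0")
    case True
    then obtain n where n: "l = int n"
      using nonneg_int_cases by blast
    have "inv_into (Obj C) (Sh C) Y \<in> w_ge" if "Y \<in> w_ge" for Y
    proof (rule w_ge_unshift)
      have "Y \<in> Sh C ` Obj C"
        using Sh_bij w_ge_Obj[OF that] by (simp add: bij_betw_def)
      then show "inv_into (Obj C) (Sh C) Y \<in> Obj C" "Sh C (inv_into (Obj C) (Sh C) Y) \<in> w_ge"
        using that by (simp_all add: inv_into_into f_inv_into_f)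
    qed
    then have "X \<in> w_ge"
      using B funpow_closed[of w_ge "inv_into (Obj C) (Sh C)"] n by (simp add: shift_by_minus_of_nat)
    then show ?thesis
      using that[of X 0] by simp
  next
    case False
    then obtain n where "- l = int n"
      using nonneg_int_cases[of "- l"] by auto
    then show ?thesis
      using B that[of B n] by (simp add: shift_by_of_nat)
  qed
qed

text \<open>Once \<open>n\<close> shifts reach \<open>w_le\<close>, so do n + (n + 1) shifts, an odd
  number.\<close>

lemma ex_odd_Sh_w_le:
  assumes "X \<in> Obj C"
  obtains n where "(Sh C ^^ (2 * n + 1)) X \<in> w_le"
proof -
  obtain n where "(Sh C ^^ n) X \<in> w_le"
    using ex_Sh_w_le[OF assms] .
  then have "(Sh C ^^ (n + 1)) ((Sh C ^^ n) X) \<in> w_le"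
    by (rule w_le_funpow_Sh)
  then have "(Sh C ^^ (2 * n + 1)) X \<in> w_le"
    by (simp add: funpow_add mult_2)
  then show ?thesis
    by (rule that)
qed

text \<open>The second triangle is the double rotation of the first, split off directly from a
  triangle of \<open>C\<close>. The last clause places \<open>(A, a)\<close> in the heart when
  \<open>X\<close> has nonnegative weights.\<close>

lemma idem_decomposition:
  assumes X: "X \<in> Obj C" "p \<in> Hom C X X" "p \<cdot> p = p"
  obtains B A a f g h f' g' h' where "B \<in> Obj C" "Sh C B \<in> w_ge" "A \<in> w_le"
    "a \<in> Hom C A A" "a \<cdot> a = a"
    "((B, ident C B), (X, p), (A, a), f, g, h) \<in> Dist (idem_tri_completion C)"
    "((A, a), (Sh C B, ident C (Sh C B)), (Sh C X, sh C p), f', g', h') \<in> Dist (idem_tri_completion C)"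
    "\<And>L c. \<lbrakk>X \<in> w_ge; L \<in> w_le; c \<in> Hom C A (Sh C L)\<rbrakk> \<Longrightarrow> c \<cdot> a = 0"
proof -
  obtain m where "(Sh C ^^ (2 * m + 1)) X \<in> w_le"
    using ex_odd_Sh_w_le[OF X(1)] .
  then obtain N Y q i j r s where Y: "Y \<in> w_le" and S: "splitting C X p Y q N i j r s"
    using ex_splitting_odd_Sh[OF X, of m] by metis
  note D = splittingD[OF S]
  note I = splitting_idem[OF splitting_swap[OF S]]
  obtain B A f g h where T: "(B, N, A, f, g, h) \<in> Dist C" and B: "Sh C B \<in> w_ge" and A: "A \<in> w_le"
    using w_decomposition[OF D(3)] .
  note t = DistD[OF T]
  \<comment> \<open>\<open>Y\<close> was chosen in \<open>w_le\<close>, so orthogonality kills the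
    component of \<open>f\<close> in \<open>Y\<close>, and the projection \<open>s\<close> extends
    along \<open>g\<close>.\<close>
  have sf: "s \<cdot> f = 0"
    using w_orth_unshift[OF t(1) B Y] comp_homI[OF D(7) t(4)] t D by blast
  obtain \<sigma>0 where \<sigma>0: "\<sigma>0 \<in> Hom C A Y" "\<sigma>0 \<cdot> g = s"
    using dist_extend[OF T D(2,7) sf] .
  define \<sigma> where "\<sigma> = q \<cdot> \<sigma>0"
  have \<sigma>: "\<sigma> \<in> Hom C A Y"
    using \<sigma>0 D t by (simp add: \<sigma>_def hom_simps)
  have \<sigma>g: "\<sigma> \<cdot> g = s"
    using \<sigma>0(1) D(1-9) t by (intro opr_eqI[of N Y])
      (simp_all add: \<sigma>_def opr_simps opr_eqs[OF \<sigma>0(1) t(5) \<sigma>0(2)] opr_eqs[OF D(9,7) I(1)])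
  have q\<sigma>: "q \<cdot> \<sigma> = \<sigma>"
    using \<sigma>0(1) D(1-9) t by (intro opr_eqI[of A Y])
      (simp_all add: \<sigma>_def opr_simps opr_eqs[OF D(9,9) I(3)])
  \<comment> \<open>The maps \<open>g \<cdot> j\<close> and \<open>\<sigma>\<close> exhibit
    \<open>(Y, q)\<close> as a summand of \<open>A\<close>; \<open>a\<close> is the complementary
    idempotent.\<close>
  define a where "a = ident C A - g \<cdot> (j \<cdot> \<sigma>)"
  have a: "a \<in> Hom C A A"
    using \<sigma> D(1-9) t by (simp add: a_def hom_simps)
  have o: "opr A A a = opr A A (ident C A) - (opr N A g \<circ> (opr Y N j \<circ> opr A Y \<sigma>))"
    using \<sigma> D(1-9) t by (simp add: a_def opr_simps)
  note eqs = opr_eqs[OF \<sigma> t(5) \<sigma>g] opr_eqs[OF D(9) \<sigma> q\<sigma>] opr_eqs[OF D(7,5,11)]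
    opr_eqs[OF D(9,7) I(1)] opr_eqs[OF D(5,9) I(2)] opr_eqs[OF D(7,4,13)]
  have aa: "a \<cdot> a = a" and agj: "a \<cdot> (g \<cdot> j) = 0" and \<sigma>a: "\<sigma> \<cdot> a = 0" and \<sigma>gi: "\<sigma> \<cdot> (g \<cdot> i) = 0"
    using \<sigma> D(1-9) t a
    by (intro opr_eqI[of A A] opr_eqI[of Y A] opr_eqI[of A Y] opr_eqI[of X Y]; simp add: opr_simps o eqs)+
  have "splitting C A a Y q A a (g \<cdot> j) a \<sigma>"
  proof -
    have "\<sigma> \<cdot> (g \<cdot> j) = q"
      using \<sigma> D(1-9) t by (intro opr_eqI[of Y Y]) (simp_all add: opr_simps eqs)
    moreover have "a \<cdot> a + g \<cdot> j \<cdot> \<sigma> = ident C A"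
      unfolding aa using \<sigma> D(1-9) t a by (intro opr_eqI[of A A]) (simp_all add: opr_simps o
        opr_comp[where g = "_ \<cdot> _" and Y = Y] comp_homI[where g = "_ \<cdot> _" and Y = Y])
    ultimately show ?thesis
      using t D(1-9) a \<sigma> aa agj \<sigma>a by (simp add: splitting_def comp_homI)
  qed
  note SA = this
  \<comment> \<open>The first vertex is decomposed as itself plus zero, so the complementary
    triangle is the trivial one on \<open>(Y, q)\<close>.\<close>
  note SB = splitting_trivial[OF t(1)]
  have hgj: "h \<cdot> (g \<cdot> j) = 0"
    using D(1-9) t by (intro opr_eqI[of Y "Sh C B"])
      (simp_all add: opr_simps opr_eqs[OF t(6,5) dist_comp_zero2[OF T]])
  have ha: "h \<cdot> a \<in> Hom C A (Sh C B)"
    using t a by (simp add: hom_simps)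
  have df: "diagonal f (ident C B) 0 r s"
  proof -
    have "f \<cdot> 0 = 0" "r \<cdot> 0 = 0"
      using comp_zero_right[of B B N f] comp_zero_right[of B N X r] t D by auto
    then show ?thesis
      using sf comp_ident_right t by (simp add: diagonal_def)
  qed
  have dg: "diagonal g i j a \<sigma>"
    using \<sigma>gi agj by (simp add: diagonal_def)
  have dh: "diagonal h a (g \<cdot> j) (sh C (ident C B)) (sh C 0)"
  proof -
    have "0 \<cdot> (h \<cdot> a) = 0"
      using comp_zero_left[of A "Sh C B" "Sh C B" "h \<cdot> a"] t ha by auto
    moreover have "sh C (ident C B) \<cdot> 0 = 0"
      using comp_zero_right[of Y "Sh C B" "Sh C B"] t D ident_hom sh_ident by simp
    ultimately show ?thesis
      using hgj by (simp add: diagonal_def)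
  qed
  note T' = dist_idem_completionI[OF T SB S SA df dg dh]
  note T'' = dist_idem_completionI[OF rotate[OF rotate[OF T]] SA splitting_Sh[OF SB] splitting_Sh[OF S] dh
      diagonal_uminus_Sh[OF SB S t(4) df] diagonal_uminus_Sh[OF S SA t(5) dg]]
  \<comment> \<open>The composite of \<open>c \<cdot> a\<close> with \<open>g\<close> vanishes on
    the summand \<open>(X, p)\<close> of \<open>N\<close> by orthogonality and on
    \<open>(Y, q)\<close> by \<open>a \<cdot> (g \<cdot> j) = 0\<close>. Hence
    \<open>c \<cdot> a\<close> factors through B[1], where orthogonality applies again.\<close>
  have orth: "c \<cdot> a = 0" if "X \<in> w_ge" "L \<in> w_le" "c \<in> Hom C A (Sh C L)" for L c
  proof -
    have L: "L \<in> Obj C" "Sh C L \<in> Obj C"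
      using that w_le_Obj by auto
    have "(c \<cdot> a) \<cdot> g \<cdot> i = 0"
    proof (rule w_orth[OF that(1,2)])
      show "c \<cdot> a \<cdot> g \<cdot> i \<in> Hom C X (Sh C L)"
        using t D(1-9) a L that(3) 
        by (intro comp_homI[where Y = N] comp_homI[where Y = A]) simp_all
    qed
    note 0 = this
    have "(c \<cdot> a) \<cdot> g = ((c \<cdot> a) \<cdot> g \<cdot> i) \<cdot> r + c \<cdot> ((a \<cdot> (g \<cdot> j)) \<cdot> s)"
    proof -
      have "opr N N (i \<cdot> r) = opr N N (ident C N - j \<cdot> s)"
        by (simp only: D(15))
      then have "opr X N i \<circ> opr N X r = opr N N (ident C N) - (opr Y N j \<circ> opr N Y s)"
        using D(1-9) by (simp add: opr_simps)
      then show ?thesis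
        using D(1-9) t a L that(3) by (intro opr_eqI[of N "Sh C L"])
          (simp_all add: opr_simps opr_comp[where g = "_ \<cdot> _" and Y = A]
            comp_homI[where g = "_ \<cdot> _" and Y = A])
    qed
    also have "\<dots> = 0"
      unfolding 0 agj using D t L that(3) comp_zero_left[of N X "Sh C L" r] comp_zero_left[of N Y A s]
        comp_zero_right[of N A "Sh C L" c] by simp
    finally have cag: "(c \<cdot> a) \<cdot> g = 0" .
    have ca: "c \<cdot> a \<in> Hom C A (Sh C L)"
      using t a L that(3) by (simp add: hom_simps)
    obtain c' where c': "c' \<in> Hom C (Sh C B) (Sh C L)" "c' \<cdot> h = c \<cdot> a"
      using dist_extend2[OF T L(2) ca cag] .
    have "c' = 0"
      using w_orth[OF B that(2) c'(1)] .
    then show ?thesis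
      using c'(2) comp_zero_left[OF t(3) _ L(2) t(6)] t by simp
  qed
  show ?thesis
    using that[OF t(1) B A a aa T' T''[unfolded sh_ident[OF t(1)]] orth] .
qed

end

section \<open>The weight structure on the idempotent completion\<close>

text \<open>These are the retracts in the completion of objects of \<open>S\<close>. The absorption
  laws for morphisms of the completion hold after replacing \<open>i\<close> by
  \<open>i \<cdot> p\<close> and \<open>r\<close> by \<open>p \<cdot> r\<close>.\<close>

definition summands :: "('o, 'm, 'z) category_scheme \<Rightarrow> 'o set \<Rightarrow> ('o \<times> 'm) set" where
  "summands C S = {(X, p). (X, p) \<in> Obj (idem_completion C) \<and>
     (\<exists>A\<in>S. \<exists>i\<in>Hom C X A. \<exists>r\<in>Hom C A X. r \<cdot>\<^bsub>C\<^esub> i = p)}"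

lemma summandsI:
  assumes "X \<in> Obj C" "p \<in> Hom C X X" "p \<cdot>\<^bsub>C\<^esub> p = p"
    "A \<in> S" "i \<in> Hom C X A" "r \<in> Hom C A X" "r \<cdot>\<^bsub>C\<^esub> i = p"
  shows "(X, p) \<in> summands C S"
  using assms by (auto simp: summands_def)

lemma summandsE:
  assumes "(X, p) \<in> summands C S"
  obtains A i r where "X \<in> Obj C" "p \<in> Hom C X X" "p \<cdot>\<^bsub>C\<^esub> p = p"
    "A \<in> S" "i \<in> Hom C X A" "r \<in> Hom C A X" "r \<cdot>\<^bsub>C\<^esub> i = p"
  using assms by (auto simp: summands_def)

lemma summands_self: "\<lbrakk>(X, p) \<in> Obj (idem_completion C); X \<in> S\<rbrakk> \<Longrightarrow> (X, p) \<in> summands C S"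
  by (auto intro: summandsI)

lemma summands_subset_Obj: "summands C S \<subseteq> Obj (idem_completion C)"
  by (auto simp: summands_def)

lemma additive_subclassD:
  assumes "additive_subclass C S"
  shows "S \<subseteq> Obj C" "\<exists>Z\<in>S. is_zero C Z"
    "\<lbrakk>X \<in> S; Y \<in> S; is_biproduct C X Y Z i j p q\<rbrakk> \<Longrightarrow> Z \<in> S"
  using assms unfolding additive_subclass_def by blast+

section \<open>Classes of summands: biproducts, retracts and isomorphic representatives\<close>

context additive_category
begin

lemma comp_eq_zero_via:
  assumes "X \<in> Obj C" "A \<in> Obj C" "Y \<in> Obj C"
    and "i \<in> Hom C X A" "r \<in> Hom C A X" "c \<in> Hom C X Y"
    and "\<And>d. d \<in> Hom C A Y \<Longrightarrow> d = 0"
  shows "c \<cdot> (r \<cdot> i) = 0"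
proof -
  have "c \<cdot> (r \<cdot> i) = (c \<cdot> r) \<cdot> i"
    using comp_assoc[OF assms(1,2,1,3,4,5,6)] by simp
  also have "c \<cdot> r = 0"
    using assms comp_homI by blast
  finally show ?thesis
    using assms comp_zero_left[of X A Y i] by simp
qed

lemma additive_subclass_summands:
  assumes S: "additive_subclass C S"
  shows "additive_subclass (idem_completion C) (summands C S)"
  unfolding additive_subclass_def
proof (intro conjI allI impI)
  have S_Obj: "A \<in> Obj C" if "A \<in> S" for A
    using additive_subclassD(1)[OF S] that by blast
  show "summands C S \<subseteq> Obj (idem_completion C)"
    by (rule summands_subset_Obj)
  obtain Z where Z: "Z \<in> S" "is_zero C Z"
    using additive_subclassD(2)[OF S] by blast
  then have "Z \<in> Obj C"
    by (simp add: is_zero_def)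
  then have "(Z, ident C Z) \<in> summands C S"
    using Z(1) by (intro summands_self) (simp_all add: ident_hom comp_ident_left)
  moreover have "is_zero (idem_completion C) (Z, ident C Z)"
    using Z(2) calculation summands_subset_Obj[of C S]
    using ident_hom[of Z] by (auto simp: is_zero_def)
  ultimately show "\<exists>Z\<in>summands C S. is_zero (idem_completion C) Z" ..
  fix M M' N i j k l
  assume M: "M \<in> summands C S" "M' \<in> summands C S" and bip: "is_biproduct (idem_completion C) M M' N i j k l"
  obtain X p Y q Z z where [simp]: "M = (X, p)" "M' = (Y, q)" "N = (Z, z)"
    by (metis prod.exhaust)
  obtain A i1 r1 where 1: "X \<in> Obj C" "p \<in> Hom C X X" "A \<in> S" "i1 \<in> Hom C X A" "r1 \<in> Hom C A X" "r1 \<cdot> i1 = p"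
    using M(1) by (auto elim: summandsE)
  obtain B i2 r2 where 2: "Y \<in> Obj C" "q \<in> Hom C Y Y" "B \<in> S" "i2 \<in> Hom C Y B" "r2 \<in> Hom C B Y" "r2 \<cdot> i2 = q"
    using M(2) by (auto elim: summandsE)
  have b: "Z \<in> Obj C" "z \<in> Hom C Z Z" "i \<in> Hom C X Z" "j \<in> Hom C Y Z" "k \<in> Hom C Z X" "l \<in> Hom C Z Y"
    and b': "z \<cdot> z = z" "i \<cdot> p = i" "j \<cdot> q = j" "i \<cdot> k + j \<cdot> l = z"
    using bip by (auto simp: is_biproduct_def)
  obtain W a b c d where w: "is_biproduct C A B W a b c d"
    using ex_biproduct S_Obj 1 2 by metis
  then have W: "W \<in> S"
    using additive_subclassD(3)[OF S 1(3) 2(3)] by blast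
  from w have w: "a \<in> Hom C A W" "b \<in> Hom C B W" "c \<in> Hom C W A" "d \<in> Hom C W B"
    "c \<cdot> a = ident C A" "d \<cdot> b = ident C B" "c \<cdot> b = 0" "d \<cdot> a = 0"
    by (auto simp: is_biproduct_def)
  note Ob = S_Obj[OF 1(3)] S_Obj[OF 2(3)] S_Obj[OF W]
  \<comment> \<open>\<open>I\<close> and \<open>R\<close> are the block diagonal maps built from
    \<open>i1\<close>, \<open>i2\<close> and from \<open>r1\<close>, \<open>r2\<close>, written
    through the decompositions of \<open>N\<close> and of \<open>W\<close>.\<close>
  define I R where "I = a \<cdot> (i1 \<cdot> k) + b \<cdot> (i2 \<cdot> l)" and "R = i \<cdot> (r1 \<cdot> c) + j \<cdot> (r2 \<cdot> d)"
  have IR: "I \<in> Hom C Z W" "R \<in> Hom C W Z"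
    using 1(1-5) 2(1-5) b w(1-4) Ob by (simp_all add: I_def R_def hom_simps)
  have oI: "opr Z W I = (opr A W a \<circ> (opr X A i1 \<circ> opr Z X k)) + (opr B W b \<circ> (opr Y B i2 \<circ> opr Z Y l))"
    using 1(1-5) 2(1-5) b w(1-4) Ob by (simp add: I_def opr_simps)
  have "R \<cdot> I = i \<cdot> k + j \<cdot> l"
    using 1(1-5) 2(1-5) b w(1-4) Ob IR
    by (intro opr_eqI[of Z Z])
      (simp_all add: R_def opr_simps oI opr_comp[where f = I and Y = W]
        comp_homI[where f = I and Y = W] opr_eqs[OF w(3,1,5)] opr_eqs[OF w(4,2,6)]
        opr_eqs[OF w(3,2,7)] opr_eqs[OF w(4,1,8)] opr_eqs[OF 1(5,4,6)] opr_eqs[OF 2(5,4,6)]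
        opr_eqs[OF b(3) 1(2) b'(2)] opr_eqs[OF b(4) 2(2) b'(3)])
  then show "N \<in> summands C S"
    using summandsI[OF b(1,2) b'(1) W IR] b'(4) by simp
qed

lemma Karoubi_closed_summands:
  assumes S: "S \<subseteq> Obj C"
  shows "Karoubi_closed (idem_completion C) (summands C S)"
  unfolding Karoubi_closed_def
proof (intro allI impI)
  fix M N assume M: "M \<in> summands C S" and ret: "is_retract (idem_completion C) N M"
  obtain X p Y q where [simp]: "M = (X, p)" "N = (Y, q)"
    by (metis prod.exhaust)
  obtain A i1 r1 where 1: "X \<in> Obj C" "p \<in> Hom C X X" "A \<in> S" "i1 \<in> Hom C X A" "r1 \<in> Hom C A X" "r1 \<cdot> i1 = p"
    using M(1) by (auto elim: summandsE)
  obtain i r where 2: "i \<in> Hom C Y X" "r \<in> Hom C X Y" "Y \<in> Obj C" "q \<in> Hom C Y Y"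
    and 3: "p \<cdot> i = i" "r \<cdot> i = q" "q \<cdot> q = q"
    using ret by (auto simp: is_retract_def)
  have A: "A \<in> Obj C"
    using 1 S by blast
  have "(r \<cdot> r1) \<cdot> (i1 \<cdot> i) = r \<cdot> i"
    using 1(1-5) 2 A by (intro opr_eqI[of Y Y]) (simp_all add: opr_simps opr_comp[where f = "_ \<cdot> _" and Y = A]
        comp_homI[where f = "_ \<cdot> _" and Y = A] opr_eqs[OF 1(5,4,6)] opr_eqs[OF 1(2) 2(1) 3(1)])
  moreover have "r \<cdot> r1 \<in> Hom C A Y" "i1 \<cdot> i \<in> Hom C Y A"
    using 1(1-5) 2 A by (simp_all add: hom_simps)
  ultimately show "N \<in> summands C S"
    using summandsI[OF 2(3,4) 3(3) 1(3)] 3(2) by simp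
qed

text \<open>Karoubi-closedness adds no new embedded objects; this yields the restriction of the new
  weight classes to the old ones.\<close>

lemma ident_in_summands_iff:
  assumes "Karoubi_closed C S" "S \<subseteq> Obj C" "X \<in> Obj C"
  shows "(X, ident C X) \<in> summands C S \<longleftrightarrow> X \<in> S"
proof
  assume "(X, ident C X) \<in> summands C S"
  then obtain A i r where "A \<in> S" "i \<in> Hom C X A" "r \<in> Hom C A X" "r \<cdot> i = ident C X"
    by (rule summandsE)
  then have "is_retract C X A"
    using assms by (auto simp: is_retract_def)
  then show "X \<in> S"
    using assms(1) \<open>A \<in> S\<close> by (auto simp: Karoubi_closed_def)
next
  assume "X \<in> S"
  then show "(X, ident C X) \<in> summands C S"
    using assms(3) by (intro summands_self) (auto simp: ident_hom comp_ident_left)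
qed

text \<open>The idempotent is transported along the retraction: \<open>i' \<cdot> r'\<close> is an
  idempotent of \<open>H\<close> with the same image as \<open>p\<close>. Every summand is thus
  represented by an idempotent on an object of \<open>S\<close> itself.\<close>

lemma summands_isomorphic:
  assumes M: "M \<in> summands C S" and S: "S \<subseteq> Obj C"
  obtains H e where "H \<in> S" "(H, e) \<in> Obj (idem_completion C)" "isomorphic (idem_completion C) (H, e) M"
proof -
  obtain X p where [simp]: "M = (X, p)"
    by (metis prod.exhaust)
  obtain H i r where 1: "X \<in> Obj C" "p \<in> Hom C X X" "p \<cdot> p = p" "H \<in> S" "i \<in> Hom C X H" "r \<in> Hom C H X" "r \<cdot> i = p"
    using M by (auto elim: summandsE)
  have H: "H \<in> Obj C"
    using 1 S by blast
  define i' r' where "i' = i \<cdot> p" and "r' = p \<cdot> r"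
  note t = H 1(1,2,5,6)
  note eqs = opr_eqs[OF 1(2,2,3)] opr_eqs[OF 1(6,5,7)]
  have ir: "i' \<in> Hom C X H" "r' \<in> Hom C H X"
    using t by (simp_all add: i'_def r'_def hom_simps)
  have o: "opr X H i' = opr X H i \<circ> opr X X p" "opr H X r' = opr X X p \<circ> opr H X r"
    using t by (simp_all add: i'_def r'_def opr_simps)
  have r'i': "r' \<cdot> i' = p" and pr': "p \<cdot> r' = r'" and i'p: "i' \<cdot> p = i'"
    using t ir by (intro opr_eqI[of X X] opr_eqI[of H X] opr_eqI[of X H]; simp add: opr_simps o eqs)+
  have ir_hom: "i' \<cdot> r' \<in> Hom C H H"
    using t ir by (simp add: hom_simps)
  have "i' \<cdot> r' \<cdot> i' = i'"
    using comp_assoc[OF 1(1) H 1(1) H ir(1,2,1)] r'i' i'p by simp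
  moreover have "r' \<cdot> (i' \<cdot> r') = r'"
    using comp_assoc[OF H 1(1) H 1(1) ir(2,1,2)] r'i' pr' by simp
  moreover have "(i' \<cdot> r') \<cdot> (i' \<cdot> r') = i' \<cdot> r'"
    using comp_assoc[OF H 1(1) H H ir(2,1) ir_hom] calculation by simp
  ultimately have e: "(i' \<cdot> r') \<cdot> (i' \<cdot> r') = i' \<cdot> r'" "(i' \<cdot> r') \<cdot> i' = i'" "r' \<cdot> (i' \<cdot> r') = r'"
    "i' \<cdot> r' \<in> Hom C H H"
    using ir_hom by auto
  have "is_iso (idem_completion C) (H, i' \<cdot> r') (X, p) r'"
    unfolding is_iso_def using ir e pr' i'p r'i' by (auto intro!: bexI[of _ i'])
  then have "isomorphic (idem_completion C) (H, i' \<cdot> r') M"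
    using t e 1(3) by (auto simp: isomorphic_def)
  then show ?thesis
    using that[OF 1(4), of "i' \<cdot> r'"] e H by simp
qed

end

section \<open>The shift on the idempotent completion\<close>

context triangulated_category
begin

lemma idem_completion_Sh:
  assumes "(X, p) \<in> Obj (idem_completion C)"
  shows "(Sh C X, sh C p) \<in> Obj (idem_completion C)"
proof -
  have "sh C p \<cdot> sh C p = sh C (p \<cdot> p)"
    using assms by (intro sh_comp[symmetric]) auto
  then show ?thesis
    using assms by (simp add: sh_hom)
qed

lemma idem_completion_Sh_iff:
  assumes "X \<in> Obj C" "p \<in> Hom C X X"
  shows "(Sh C X, sh C p) \<in> Obj (idem_completion C) \<longleftrightarrow> (X, p) \<in> Obj (idem_completion C)"
proof
  assume "(Sh C X, sh C p) \<in> Obj (idem_completion C)"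
  then have "sh C (p \<cdot> p) = sh C p"
    unfolding sh_comp[OF assms(1,1,1,2,2)] by simp
  then have "p \<cdot> p = p"
    by (rule sh_inj[of X X, rotated 4]) (use assms in \<open>simp_all add: hom_simps\<close>)
  then show "(X, p) \<in> Obj (idem_completion C)"
    using assms by simp
qed (rule idem_completion_Sh)

lemma idem_completion_Sh_surj:
  assumes "(X, p) \<in> Obj (idem_completion C)"
  obtains X0 p0 where "(X0, p0) \<in> Obj (idem_completion C)" "X = Sh C X0" "p = sh C p0"
proof -
  obtain X0 where X0: "X0 \<in> Obj C" "X = Sh C X0"
    using assms Sh_surj[of X] unfolding idem_completion_Obj by blast
  have "p \<in> Hom C (Sh C X0) (Sh C X0)"
    using assms X0(2) by simp
  then obtain p0 where p0: "p0 \<in> Hom C X0 X0" "p = sh C p0"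
    by (rule sh_surj[OF X0(1,1)])
  have "(X0, p0) \<in> Obj (idem_completion C)"
    using assms idem_completion_Sh_iff[OF X0(1) p0(1)] unfolding X0(2) p0(2) by blast
  then show ?thesis
    using that X0(2) p0(2) by blast
qed

lemma idem_completion_Sh_bij:
  "bij_betw (Sh (idem_tri_completion C)) (Obj (idem_tri_completion C)) (Obj (idem_tri_completion C))"
  unfolding bij_betw_def
proof
  show "inj_on (Sh (idem_tri_completion C)) (Obj (idem_tri_completion C))"
  proof (rule inj_onI)
    fix M N assume *: "M \<in> Obj (idem_tri_completion C)" "N \<in> Obj (idem_tri_completion C)"
      "Sh (idem_tri_completion C) M = Sh (idem_tri_completion C) N"
    obtain X p Y q where [simp]: "M = (X, p)" "N = (Y, q)"
      by (metis prod.exhaust)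
    have "X = Y"
      using * Sh_bij by (auto simp: bij_betw_def inj_on_def)
    then show "M = N"
      using * sh_inj[of X X p q] by auto
  qed
  show "Sh (idem_tri_completion C) ` Obj (idem_tri_completion C) = Obj (idem_tri_completion C)"
  proof
    show "Sh (idem_tri_completion C) ` Obj (idem_tri_completion C) \<subseteq> Obj (idem_tri_completion C)"
      using idem_completion_Sh by auto
    show "Obj (idem_tri_completion C) \<subseteq> Sh (idem_tri_completion C) ` Obj (idem_tri_completion C)"
    proof
      fix M assume "M \<in> Obj (idem_tri_completion C)"
      then have *: "(fst M, snd M) \<in> Obj (idem_completion C)"
        by (simp del: idem_completion_Obj)
      obtain X0 p0 where "(X0, p0) \<in> Obj (idem_completion C)" "M = (Sh C X0, sh C p0)"
        using idem_completion_Sh_surj[OF *] by (metis prod.collapse)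
      then show "M \<in> Sh (idem_tri_completion C) ` Obj (idem_tri_completion C)"
        by (intro image_eqI[of _ _ "(X0, p0)"]) simp_all
    qed
  qed
qed

lemma idem_completion_unshift:
  assumes "(X, p) \<in> Obj (idem_completion C)"
  shows "shift_by (idem_tri_completion C) (-1) (Sh C X, sh C p) = (X, p)"
  using inv_into_funpow(1)[OF idem_completion_Sh_bij, of "(X, p)" 1] assms by (simp add: shift_by_minus_one)

lemma idem_completion_funpow_Sh:
  "(Sh (idem_tri_completion C) ^^ n) (X, p) = ((Sh C ^^ n) X, (sh C ^^ n) p)"
  by (induction n) simp_all

lemma summands_Sh:
  assumes "M \<in> summands C S" "S \<subseteq> Obj C" "Sh C ` S \<subseteq> S'"
  shows "Sh (idem_tri_completion C) M \<in> summands C S'"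
proof -
  obtain X p where [simp]: "M = (X, p)"
    by (metis prod.exhaust)
  obtain A i r where 1: "X \<in> Obj C" "p \<in> Hom C X X" "p \<cdot> p = p" "A \<in> S" "i \<in> Hom C X A" "r \<in> Hom C A X" "r \<cdot> i = p"
    using assms(1) by (auto elim: summandsE)
  then have A: "A \<in> Obj C" "Sh C A \<in> S'"
    using assms by auto
  have "(Sh C X, sh C p) \<in> summands C S'"
    using idem_completion_Sh[of X p] 1 A sh_hom[OF 1(1) A(1) 1(5)] sh_hom[OF A(1) 1(1,6)] sh_comp[OF 1(1) A(1) 1(1,5,6)]
    by (intro summandsI[of _ _ _ "Sh C A" _ "sh C i" "sh C r"]) simp_all
  then show ?thesis by simp
qed

lemma summands_unshift:
  assumes "M \<in> summands C S" "S0 \<subseteq> Obj C" "S \<subseteq> Sh C ` S0"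
  shows "M \<in> Sh (idem_tri_completion C) ` summands C S0"
proof -
  obtain X p where M [simp]: "M = (X, p)"
    by (metis prod.exhaust)
  obtain A i r where 1: "X \<in> Obj C" "A \<in> S" "i \<in> Hom C X A" "r \<in> Hom C A X" "r \<cdot> i = p"
    using assms(1) by (auto elim: summandsE)
  have "(X, p) \<in> Obj (idem_completion C)"
    using assms(1) summands_subset_Obj unfolding M by blast
  then obtain X0 p0 where X0: "(X0, p0) \<in> Obj (idem_completion C)" "X = Sh C X0" "p = sh C p0"
    by (rule idem_completion_Sh_surj)
  obtain A0 where A0: "A0 \<in> S0" "A = Sh C A0" "A0 \<in> Obj C"
    using 1(2) assms(2,3) by blast
  have X0': "X0 \<in> Obj C"
    using X0 by simp
  obtain i0 where i0: "i0 \<in> Hom C X0 A0" "i = sh C i0"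
    using sh_surj[OF X0' A0(3)] 1(3) unfolding X0(2) A0(2) by blast
  obtain r0 where r0: "r0 \<in> Hom C A0 X0" "r = sh C r0"
    using sh_surj[OF A0(3) X0'] 1(4) unfolding X0(2) A0(2) by blast
  have "sh C (r0 \<cdot> i0) = sh C p0"
    using sh_comp[of X0 A0 X0 i0 r0] 1(5) X0 A0 i0 r0 by simp
  then have "r0 \<cdot> i0 = p0"
    by (rule sh_inj[of X0 X0, rotated 4]) (use X0 A0 i0 r0 in \<open>simp_all add: hom_simps\<close>)
  then have "(X0, p0) \<in> summands C S0"
    using X0 A0 i0 r0 by (intro summandsI) simp_all
  then show ?thesis
    using X0 by (intro image_eqI[of _ _ "(X0, p0)"]) simp_all
qed

end

section \<open>Weight axioms, boundedness and heart in the completion\<close>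

context bounded_weight_category
begin

abbreviation "w_le' \<equiv> summands C w_le"
abbreviation "w_ge' \<equiv> summands C w_ge"

lemma w_subset_Obj: "w_le \<subseteq> Obj C" "w_ge \<subseteq> Obj C"
  using w_le_Obj w_ge_Obj by auto

lemma summands_w_ge_orth:
  assumes "(X, p) \<in> w_ge'" "L \<in> w_le" "c \<in> Hom C X (Sh C L)"
  shows "c \<cdot> p = 0"
proof -
  obtain A i r where 1: "X \<in> Obj C" "A \<in> w_ge" "i \<in> Hom C X A" "r \<in> Hom C A X" "r \<cdot> i = p"
    using assms(1) by (auto elim: summandsE)
  show ?thesis
    unfolding 1(5)[symmetric]
    by (rule comp_eq_zero_via[of X A "Sh C L"]) (use 1 assms w_orth[OF 1(2)] w_le_Obj w_ge_Obj in auto)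
qed

lemma orthogonal_summands:
  "orthogonal (idem_tri_completion C) w_ge' (Sh (idem_tri_completion C) ` w_le')"
proof -
  have "f = 0" if M: "(X, p) \<in> w_ge'" and N: "(Y, q) \<in> w_le'"
    and f: "f \<in> Hom (idem_completion C) (X, p) (Sh C Y, sh C q)" for X p Y q f
  proof -
    obtain A i r where 1: "Y \<in> Obj C" "A \<in> w_le" "i \<in> Hom C Y A" "r \<in> Hom C A Y" "r \<cdot> i = q"
      using N by (auto elim: summandsE)
    note A = w_le_Obj[OF 1(2)]
    have X: "X \<in> Obj C" "f \<in> Hom C X (Sh C Y)" "f \<cdot> p = f" "sh C q \<cdot> f = f" "p \<in> Hom C X X"
      using M f by (auto elim: summandsE)
    note sh = sh_hom[OF 1(1) A 1(3)] sh_hom[OF A 1(1,4)] 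
    note Sh = Sh_Obj[OF 1(1)] Sh_Obj[OF A]
    \<comment> \<open>\<open>sh C i \<cdot> f\<close> ends in the shift of an object of
      \<open>w_le\<close>, so it vanishes; \<open>f\<close> is recovered from it by applying
      \<open>sh C r\<close>.\<close>
    have "(sh C i \<cdot> f) \<cdot> p = 0"
      by (rule summands_w_ge_orth[OF M 1(2)]) (use sh Sh X in \<open>simp add: hom_simps\<close>)
    then have "sh C i \<cdot> f = 0"
      using comp_assoc[OF X(1,1) Sh X(5,2) sh(1)] X(3) by simp
    moreover have "f = sh C r \<cdot> (sh C i \<cdot> f)"
      using comp_assoc[OF X(1) Sh Sh(1) X(2) sh] sh_comp[OF 1(1) A 1(1,3,4)] 1(5) X(4) by simp
    ultimately show ?thesis
      using comp_zero_right[OF X(1) Sh(2,1) sh(2)] by simp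
  qed
  moreover have "0 \<in> Hom (idem_completion C) (X, p) (Sh C Y, sh C q)"
    if "(X, p) \<in> w_ge'" "(Y, q) \<in> w_le'" for X p Y q
    using that by (auto elim!: summandsE
      simp: zero_hom sh_hom comp_zero_left[of X X "Sh C Y"] comp_zero_right[of X "Sh C Y" "Sh C Y"])
  ultimately show ?thesis
    unfolding orthogonal_def by fastforce
qed

lemma weight_structure_idem_completion:
  "weight_structure (idem_tri_completion C) w_le' w_ge'"
  unfolding weight_structure_def shift_by_one
proof (intro conjI)
  have *: "additive_subclass (idem_tri_completion C) S \<longleftrightarrow> additive_subclass (idem_completion C) S"
    "Karoubi_closed (idem_tri_completion C) S \<longleftrightarrow> Karoubi_closed (idem_completion C) S" for S
    by (simp_all add: additive_subclass_def Karoubi_closed_def is_zero_def is_biproduct_def is_retract_def)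
  show "additive_subclass (idem_tri_completion C) w_le'" "additive_subclass (idem_tri_completion C) w_ge'"
    unfolding * using weightD(1,2) by (auto intro: additive_subclass_summands)
  show "Karoubi_closed (idem_tri_completion C) w_le'" "Karoubi_closed (idem_tri_completion C) w_ge'"
    unfolding * using w_subset_Obj by (auto intro: Karoubi_closed_summands)
  show "w_ge' \<subseteq> Sh (idem_tri_completion C) ` w_ge'"
    using summands_unshift[OF _ w_subset_Obj(2) weightD(5)] by blast
  show "Sh (idem_tri_completion C) ` w_le' \<subseteq> w_le'"
    using summands_Sh[OF _ w_subset_Obj(1) weightD(6)] by blast
  show "orthogonal (idem_tri_completion C) w_ge' (Sh (idem_tri_completion C) ` w_le')"
    by (rule orthogonal_summands)
  show "\<forall>M\<in>Obj (idem_tri_completion C). \<exists>A\<in>w_le'. \<exists>B\<in>w_ge'. \<exists>f g h.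
      (shift_by (idem_tri_completion C) (- 1) B, M, A, f, g, h) \<in> Dist (idem_tri_completion C)"
  proof
    fix M assume M: "M \<in> Obj (idem_tri_completion C)"
    obtain X p where [simp]: "M = (X, p)"
      by (metis prod.exhaust)
    from M have "X \<in> Obj C" "p \<in> Hom C X X" "p \<cdot> p = p"
      by auto
    then obtain B A a f g h where *: "B \<in> Obj C" "Sh C B \<in> w_ge" "A \<in> w_le" "a \<in> Hom C A A" "a \<cdot> a = a"
      "((B, ident C B), (X, p), (A, a), f, g, h) \<in> Dist (idem_tri_completion C)"
      by (rule idem_decomposition)
    have B: "(B, ident C B) \<in> Obj (idem_completion C)"
      using * by (simp add: ident_hom comp_ident_left)
    then have "shift_by (idem_tri_completion C) (-1) (Sh C B, sh C (ident C B)) = (B, ident C B)"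
      by (rule idem_completion_unshift)
    moreover have "(Sh C B, sh C (ident C B)) \<in> w_ge'"
      using idem_completion_Sh[OF B] *(2) by (rule summands_self)
    moreover have "(A, a) \<in> w_le'"
      using * w_le_Obj by (intro summands_self) auto
    ultimately show "\<exists>A\<in>w_le'. \<exists>B\<in>w_ge'. \<exists>f g h.
      (shift_by (idem_tri_completion C) (- 1) B, M, A, f, g, h) \<in> Dist (idem_tri_completion C)"
      using *(6) unfolding \<open>M = (X, p)\<close> by metis
  qed
qed

lemma idem_ex_w_ge_Sh:
  assumes "(X, p) \<in> Obj (idem_completion C)"
  obtains n Y q where "Y \<in> w_ge" "(Y, q) \<in> Obj (idem_completion C)"
    "(X, p) = (Sh (idem_tri_completion C) ^^ n) (Y, q)"
proof -
  have "X \<in> Obj C"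
    using assms by simp
  then obtain n Y where Y: "Y \<in> w_ge" "X = (Sh C ^^ n) Y"
    by (rule ex_w_ge_Sh)
  \<comment> \<open>Surjectivity in the completion supplies the desuspended idempotent; injectivity
    on objects of \<open>C\<close> then identifies its underlying object with
    \<open>Y\<close>.\<close>
  have "bij_betw (Sh (idem_tri_completion C) ^^ n) (Obj (idem_completion C)) (Obj (idem_completion C))"
    using bij_betw_funpow[OF idem_completion_Sh_bij, of n] by simp
  then obtain Y' q where q: "(Y', q) \<in> Obj (idem_completion C)" "(X, p) = (Sh (idem_tri_completion C) ^^ n) (Y', q)"
    using assms unfolding bij_betw_def by (metis (no_types, lifting) imageE prod.collapse)
  have "(Sh C ^^ n) Y' = (Sh C ^^ n) Y"
    using q(2) Y(2) by (simp add: idem_completion_funpow_Sh)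
  then have "Y' = Y"
    using bij_betw_funpow[OF Sh_bij, of n] q(1) w_ge_Obj[OF Y(1)] by (auto simp: bij_betw_def inj_on_def)
  then show ?thesis
    using that Y q by blast
qed

lemma bounded_weight_structure_idem_completion:
  "bounded_weight_structure (idem_tri_completion C) w_le' w_ge'"
  unfolding bounded_weight_structure_def
proof (intro conjI)
  show "weight_structure (idem_tri_completion C) w_le' w_ge'"
    by (rule weight_structure_idem_completion)
  show "(\<Union>l::int. shift_by (idem_tri_completion C) (- l) ` w_le') = Obj (idem_tri_completion C)"
  proof (rule bounded_leI[OF idem_completion_Sh_bij])
    fix M assume M: "M \<in> Obj (idem_tri_completion C)"
    obtain X p where [simp]: "M = (X, p)"
      by (metis prod.exhaust)
    obtain n where "(Sh C ^^ n) X \<in> w_le"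
      using M by (auto intro: ex_Sh_w_le)
    moreover have "(Sh (idem_tri_completion C) ^^ n) M \<in> Obj (idem_completion C)"
      using M by (intro funpow_closed) (auto intro: idem_completion_Sh simp del: idem_completion_Obj)
    ultimately have "(Sh (idem_tri_completion C) ^^ n) M \<in> w_le'"
      by (simp add: idem_completion_funpow_Sh summands_self del: idem_completion_Obj)
    then show "\<exists>n. (Sh (idem_tri_completion C) ^^ n) M \<in> w_le'" ..
  qed (simp add: summands_subset_Obj)
  show "(\<Union>l::int. shift_by (idem_tri_completion C) (- l) ` w_ge') = Obj (idem_tri_completion C)"
  proof (rule bounded_geI[OF idem_completion_Sh_bij])
    fix M assume M: "M \<in> Obj (idem_tri_completion C)"
    obtain X p where [simp]: "M = (X, p)"
      by (metis prod.exhaust)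
    have "(X, p) \<in> Obj (idem_completion C)"
      using M by simp
    then obtain n Y q where "Y \<in> w_ge" "(Y, q) \<in> Obj (idem_completion C)"
      "(X, p) = (Sh (idem_tri_completion C) ^^ n) (Y, q)"
      by (rule idem_ex_w_ge_Sh)
    then show "\<exists>n. \<exists>Y\<in>w_ge'. M = (Sh (idem_tri_completion C) ^^ n) Y"
      using summands_self[of Y q C w_ge] by auto
  qed (simp add: summands_subset_Obj)
qed

lemma extends_weight_structure_summands: "extends_weight_structure C w_le' w_ge' w_le w_ge"
  using ident_in_summands_iff[OF weightD(3) w_subset_Obj(1)]
    ident_in_summands_iff[OF weightD(4) w_subset_Obj(2)] w_subset_Obj
  by (auto simp: extends_weight_structure_def idem_embedding_def)

text \<open>In a triangle L \<rightarrow> B \<rightarrow> A \<rightarrow> L[1] with \<open>B\<close>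
  in \<open>w_ge\<close>, \<open>B\<close> is also in \<open>w_le\<close> as an extension of
  \<open>A\<close> by \<open>L\<close>. By the orthogonality premise \<open>i \<cdot> p\<close>
  lifts to \<open>B\<close>, so \<open>(X, p)\<close> is a summand of the heart object
  \<open>B\<close>.\<close>

lemma summands_heartI:
  assumes M: "(X, p) \<in> w_le'" and orth: "\<And>L c. \<lbrakk>L \<in> w_le; c \<in> Hom C X (Sh C L)\<rbrakk> \<Longrightarrow> c \<cdot> p = 0"
  shows "(X, p) \<in> summands C (w_ge \<inter> w_le)"
proof -
  obtain A i r where 1: "X \<in> Obj C" "p \<in> Hom C X X" "p \<cdot> p = p" "A \<in> w_le" "i \<in> Hom C X A" "r \<in> Hom C A X" "r \<cdot> i = p"
    using M by (auto elim: summandsE)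
  note A = w_le_Obj[OF 1(4)]
  obtain L B e f g where T': "(L, B, A, e, f, g) \<in> Dist C" and B: "B \<in> w_ge" and L: "L \<in> w_le"
    using w_decomposition'[OF A] .
  note B_le = w_le_extension[OF T' L 1(4)]
  note T = rotate[OF T']
  note t = DistD[OF T]
  have "g \<cdot> (i \<cdot> p) = 0"
    using orth[OF L, of "g \<cdot> i"] t comp_assoc[OF 1(1,1) A t(3) 1(2,5) t(5)] 1 by (simp add: hom_simps)
  moreover have ip: "i \<cdot> p \<in> Hom C X A"
    using 1 A by (simp add: hom_simps)
  ultimately obtain i' where i': "i' \<in> Hom C X B" "f \<cdot> i' = i \<cdot> p"
    using dist_lift[OF T 1(1)] by blast
  have "(r \<cdot> f) \<cdot> i' = r \<cdot> (i \<cdot> p)"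
    using i' comp_assoc[OF 1(1) t(1,2) 1(1) i'(1) t(4) 1(6)] by simp
  also have "\<dots> = p"
    using comp_assoc[OF 1(1,1) A 1(1,2,5,6)] 1 by simp
  finally show ?thesis
    using 1 B B_le i' t by (intro summandsI[of _ _ _ B _ i' "r \<cdot> f"]) (simp_all add: hom_simps)
qed

lemma heart_idem_completion: "w_ge' \<inter> w_le' = summands C (w_ge \<inter> w_le)"
proof
  show "w_ge' \<inter> w_le' \<subseteq> summands C (w_ge \<inter> w_le)"
    using summands_heartI summands_w_ge_orth by auto
  show "summands C (w_ge \<inter> w_le) \<subseteq> w_ge' \<inter> w_le'"
    by (auto simp: summands_def)
qed

end

section \<open>The heart of the idempotent completion\<close>

lemma full_subcategory_simps [simp]:
  "Obj (full_subcategory C S) = S" "Hom (full_subcategory C S) = Hom C"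
  "ident (full_subcategory C S) = ident C" "Comp (full_subcategory C S) = Comp C"
  by (simp_all add: full_subcategory_def)

lemma id_functor_simps [simp]: "on_obj id_functor X = X" "on_mor id_functor X Y f = f"
  by (simp_all add: id_functor_def)

lemma comp_functor_simps [simp]:
  "on_obj (comp_functor G F) X = on_obj G (on_obj F X)"
  "on_mor (comp_functor G F) X Y f = on_mor G (on_obj F X) (on_obj F Y) (on_mor F X Y f)"
  by (simp_all add: comp_functor_def)

text \<open>Conjugation with chosen isomorphisms from \<open>R X\<close> in \<open>S\<close> to
  \<open>X\<close> gives a quasi-inverse of the inclusion.\<close>

lemma (in additive_category) equivalent_full_subcategory:
  assumes S: "S \<subseteq> S'" "S' \<subseteq> Obj C" and iso: "\<And>X. X \<in> S' \<Longrightarrow> \<exists>Y\<in>S. isomorphic C Y X"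
  shows "equivalent_categories (full_subcategory C S') (full_subcategory C S)"
proof -
  have "\<exists>Y f g. Y \<in> S \<and> f \<in> Hom C Y X \<and> g \<in> Hom C X Y \<and> g \<cdot> f = ident C Y \<and> f \<cdot> g = ident C X"
    if "X \<in> S'" for X
    using iso[OF that] unfolding isomorphic_def is_iso_def by blast
  then obtain R \<phi> \<psi> where R: "R X \<in> S" and \<phi>: "\<phi> X \<in> Hom C (R X) X" and \<psi>: "\<psi> X \<in> Hom C X (R X)"
    and \<psi>\<phi>: "\<psi> X \<cdot> \<phi> X = ident C (R X)" and \<phi>\<psi>: "\<phi> X \<cdot> \<psi> X = ident C X" if "X \<in> S'" for X
    by metis
  have Ob [simp]: "X \<in> Obj C" "R X \<in> Obj C" "R X \<in> S'" if "X \<in> S'" for X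
    using that S R by blast+
  define F where "F = \<lparr>on_obj = R, on_mor = (\<lambda>X Y f. \<psi> Y \<cdot> (f \<cdot> \<phi> X))\<rparr>"
  have F [simp]: "on_obj F X = R X" "on_mor F X Y f = \<psi> Y \<cdot> (f \<cdot> \<phi> X)" for X Y f
    by (simp_all add: F_def)
  have F_hom: "\<psi> Y \<cdot> (f \<cdot> \<phi> X) \<in> Hom C (R X) (R Y)" if "X \<in> S'" "Y \<in> S'" "f \<in> Hom C X Y" for X Y f
    using \<phi>[OF that(1)] \<psi>[OF that(2)] that by (simp add: hom_simps)
  have "additive_functor (full_subcategory C S') (full_subcategory C S) F"
    unfolding additive_functor_def full_subcategory_simps F
  proof (intro conjI ballI)
    fix X assume X: "X \<in> S'"
    show "R X \<in> S"
      by (rule R[OF X])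
    show "\<psi> X \<cdot> (ident C X \<cdot> \<phi> X) = ident C (R X)"
      using comp_ident_left[OF _ _ \<phi>[OF X]] \<psi>\<phi>[OF X] X by simp
  next
    fix X Y f assume "X \<in> S'" "Y \<in> S'" "f \<in> Hom C X Y"
    then show "\<psi> Y \<cdot> (f \<cdot> \<phi> X) \<in> Hom C (R X) (R Y)"
      by (rule F_hom)
  next
    fix X Y Z f g assume *: "X \<in> S'" "Y \<in> S'" "Z \<in> S'" "f \<in> Hom C X Y" "g \<in> Hom C Y Z"
    note t = \<phi>[OF *(1)] \<phi>[OF *(2)] \<psi>[OF *(2)] \<psi>[OF *(3)]
    show "\<psi> Z \<cdot> (g \<cdot> f \<cdot> \<phi> X) = \<psi> Z \<cdot> (g \<cdot> \<phi> Y) \<cdot> (\<psi> Y \<cdot> (f \<cdot> \<phi> X))"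
      using * t by (intro opr_eqI[of "R X" "R Z"]) (simp_all add: opr_simps opr_comp[where f = "_ \<cdot> _" and Y = "R Y"]
        comp_homI[where f = "_ \<cdot> _" and Y = "R Y"] opr_eqs[OF t(2,3) \<phi>\<psi>[OF *(2)]])
  next
    fix X Y f g assume *: "X \<in> S'" "Y \<in> S'" "f \<in> Hom C X Y" "g \<in> Hom C X Y"
    show "\<psi> Y \<cdot> ((f + g) \<cdot> \<phi> X) = \<psi> Y \<cdot> (f \<cdot> \<phi> X) + \<psi> Y \<cdot> (g \<cdot> \<phi> X)"
      using * \<phi>[OF *(1)] \<psi>[OF *(2)] by (intro opr_eqI[of "R X" "R Y"]) (simp_all add: opr_simps)
  qed
  moreover have "additive_functor (full_subcategory C S) (full_subcategory C S') id_functor"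
    using S by (auto simp: additive_functor_def)
  moreover have "natural_iso (full_subcategory C S') (full_subcategory C S') id_functor (comp_functor id_functor F) \<psi>"
    unfolding natural_iso_def
  proof (intro conjI ballI)
    fix X assume "X \<in> Obj (full_subcategory C S')"
    then show "is_iso (full_subcategory C S') (on_obj id_functor X) (on_obj (comp_functor id_functor F) X) (\<psi> X)"
      using \<phi> \<psi> \<phi>\<psi> \<psi>\<phi> by (auto simp: is_iso_def intro!: bexI[of _ "\<phi> X"])
  next
    fix X Y f assume "X \<in> Obj (full_subcategory C S')" "Y \<in> Obj (full_subcategory C S')"
      "f \<in> Hom (full_subcategory C S') X Y"
    then have *: "X \<in> S'" "Y \<in> S'" "f \<in> Hom C X Y"
      by auto
    note t = \<phi>[OF *(1)] \<psi>[OF *(1)] \<psi>[OF *(2)]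
    have "\<psi> Y \<cdot> f = \<psi> Y \<cdot> (f \<cdot> \<phi> X) \<cdot> \<psi> X"
      using * t by (intro opr_eqI[of X "R Y"]) (simp_all add: opr_simps opr_eqs[OF t(1,2) \<phi>\<psi>[OF *(1)]])
    then show "\<psi> Y \<cdot>\<^bsub>full_subcategory C S'\<^esub> on_mor id_functor X Y f =
        on_mor (comp_functor id_functor F) X Y f \<cdot>\<^bsub>full_subcategory C S'\<^esub> \<psi> X"
      by simp
  qed
  moreover have "natural_iso (full_subcategory C S) (full_subcategory C S) (comp_functor F id_functor) id_functor \<phi>"
    unfolding natural_iso_def
  proof (intro conjI ballI)
    fix X assume "X \<in> Obj (full_subcategory C S)"
    then show "is_iso (full_subcategory C S) (on_obj (comp_functor F id_functor) X) (on_obj id_functor X) (\<phi> X)"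
      using \<phi> \<psi> \<phi>\<psi> \<psi>\<phi> S(1) by (auto simp: is_iso_def subset_iff intro!: bexI[of _ "\<psi> X"])
  next
    fix X Y f assume "X \<in> Obj (full_subcategory C S)" "Y \<in> Obj (full_subcategory C S)"
      "f \<in> Hom (full_subcategory C S) X Y"
    then have *: "X \<in> S'" "Y \<in> S'" "f \<in> Hom C X Y"
      using S(1) by auto
    note t = \<phi>[OF *(1)] \<phi>[OF *(2)] \<psi>[OF *(2)]
    have "\<phi> Y \<cdot> (\<psi> Y \<cdot> (f \<cdot> \<phi> X)) = f \<cdot> \<phi> X"
      using * t by (intro opr_eqI[of "R X" Y]) (simp_all add: opr_simps opr_eqs[OF t(2,3) \<phi>\<psi>[OF *(2)]])
    then show "\<phi> Y \<cdot>\<^bsub>full_subcategory C S\<^esub> on_mor (comp_functor F id_functor) X Y f =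
        on_mor id_functor X Y f \<cdot>\<^bsub>full_subcategory C S\<^esub> \<phi> X"
      by simp
  qed
  ultimately show ?thesis
    unfolding equivalent_categories_def by blast
qed

section \<open>Additivity of the idempotent completion\<close>

lemma (in additive_category) idem_completion_biproduct:
  assumes "(X, p) \<in> Obj (idem_completion C)" "(Y, q) \<in> Obj (idem_completion C)"
  shows "\<exists>N i j r s. is_biproduct (idem_completion C) (X, p) (Y, q) N i j r s"
proof -
  have 1: "X \<in> Obj C" "Y \<in> Obj C" "p \<in> Hom C X X" "q \<in> Hom C Y Y" "p \<cdot> p = p" "q \<cdot> q = q"
    using assms by auto
  obtain Z i j k l where bip: "is_biproduct C X Y Z i j k l"
    using ex_biproduct 1 by metis
  then have b: "Z \<in> Obj C" "i \<in> Hom C X Z" "j \<in> Hom C Y Z" "k \<in> Hom C Z X" "l \<in> Hom C Z Y"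
    "k \<cdot> i = ident C X" "l \<cdot> j = ident C Y" "k \<cdot> j = 0" "l \<cdot> i = 0"
    by (auto simp: is_biproduct_def)
  note t = 1(1-4) b(1-5)
  define I J K L where "I = i \<cdot> p" and "J = j \<cdot> q" and "K = p \<cdot> k" and "L = q \<cdot> l"
  note d = I_def J_def K_def L_def
  have h: "I \<in> Hom C X Z" "J \<in> Hom C Y Z" "K \<in> Hom C Z X" "L \<in> Hom C Z Y"
    using t by (simp_all add: d hom_simps)
  note eqs = opr_eqs[OF b(4,2,6)] opr_eqs[OF b(5,3,7)] opr_eqs[OF b(4,3,8)] opr_eqs[OF b(5,2,9)]
    opr_eqs[OF 1(3,3,5)] opr_eqs[OF 1(4,4,6)]
  have o: "opr X Z I = opr X Z i \<circ> opr X X p" "opr Y Z J = opr Y Z j \<circ> opr Y Y q"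
    "opr Z X K = opr X X p \<circ> opr Z X k" "opr Z Y L = opr Y Y q \<circ> opr Z Y l"
    using t by (simp_all add: d opr_simps)
  \<comment> \<open>On the biproduct \<open>Z\<close> formed in \<open>C\<close>, \<open>z\<close>
    is the direct sum of \<open>p\<close> and \<open>q\<close>.\<close>
  define z where "z = I \<cdot> K + J \<cdot> L"
  have z: "z \<in> Hom C Z Z"
    using t h by (simp add: z_def hom_simps)
  have oz: "opr Z Z z = (opr X Z i \<circ> (opr X X p \<circ> opr Z X k)) + (opr Y Z j \<circ> (opr Y Y q \<circ> opr Z Y l))"
    using t h by (simp add: z_def opr_simps o eqs)
  have zz: "z \<cdot> z = z"
    using t h z by (intro opr_eqI[of Z Z]) (simp_all add: opr_simps o oz eqs)
  have zI: "z \<cdot> I = I" and Ip: "I \<cdot> p = I"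
    using t h z by (intro opr_eqI[of X Z]; simp add: opr_simps o oz eqs)+
  have zJ: "z \<cdot> J = J" and Jq: "J \<cdot> q = J"
    using t h z by (intro opr_eqI[of Y Z]; simp add: opr_simps o oz eqs)+
  have Kz: "K \<cdot> z = K" and pK: "p \<cdot> K = K"
    using t h z by (intro opr_eqI[of Z X]; simp add: opr_simps o oz eqs)+
  have Lz: "L \<cdot> z = L" and qL: "q \<cdot> L = L"
    using t h z by (intro opr_eqI[of Z Y]; simp add: opr_simps o oz eqs)+
  have KI: "K \<cdot> I = p"
    using t h by (intro opr_eqI[of X X]; simp add: opr_simps o eqs)+
  have LJ: "L \<cdot> J = q"
    using t h by (intro opr_eqI[of Y Y]; simp add: opr_simps o eqs)+
  have KJ: "K \<cdot> J = 0"
    using t h by (intro opr_eqI[of Y X]; simp add: opr_simps o eqs)+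
  have LI: "L \<cdot> I = 0"
    using t h by (intro opr_eqI[of X Y]; simp add: opr_simps o eqs)+
  have "is_biproduct (idem_completion C) (X, p) (Y, q) (Z, z) I J K L"
    unfolding is_biproduct_def
    using 1 t h z zz zI Ip zJ Jq Kz pK Lz qL KI LJ KJ LI by (simp add: z_def)
  then show ?thesis by blast
qed

lemma (in additive_category) additive_idem_completion: "additive_category (idem_completion C)"
proof
  show "\<exists>Z. is_zero (idem_completion C) Z"
  proof -
    \<comment> \<open>The zero object is obtained by regarding all of \<open>C\<close> as an
      additive class and passing to its summands.\<close>
    have "additive_subclass C (Obj C)"
      using ex_zero unfolding additive_subclass_def is_zero_def is_biproduct_def by blast
    then show ?thesis
      using additive_subclassD(2)[OF additive_subclass_summands[of "Obj C"]] by blast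
  qed
  show "\<exists>N i j r s. is_biproduct (idem_completion C) M M' N i j r s"
    if "M \<in> Obj (idem_completion C)" "M' \<in> Obj (idem_completion C)" for M M'
    using that idem_completion_biproduct by (cases M; cases M') blast
  show "g \<cdot>\<^bsub>idem_completion C\<^esub> f \<in> Hom (idem_completion C) L N"
    if "L \<in> Obj (idem_completion C)" "M \<in> Obj (idem_completion C)" "N \<in> Obj (idem_completion C)"
      "f \<in> Hom (idem_completion C) L M" "g \<in> Hom (idem_completion C) M N" for L M N f g
  proof -
    obtain X p Y q Z r where [simp]: "L = (X, p)" "M = (Y, q)" "N = (Z, r)"
      by (metis prod.exhaust)
    have "r \<cdot> (g \<cdot> f) = (r \<cdot> g) \<cdot> f" "(g \<cdot> f) \<cdot> p = g \<cdot> (f \<cdot> p)"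
      using that comp_assoc[of X Y Z Z f g r] comp_assoc[of X X Y Z p f g] by auto
    then show ?thesis
      using that by (auto simp: comp_homI)
  qed
qed (auto simp: comp_assoc comp_uminus_left comp_uminus_right comp_ident_left comp_ident_right zero_hom add_hom
    uminus_hom comp_add_left comp_add_right)

lemma (in additive_category) ident_in_idem_completion:
  "X \<in> Obj C \<Longrightarrow> (X, ident C X) \<in> Obj (idem_completion C)"
  by (simp add: ident_hom comp_ident_left)

section \<open>Preparations for generation by the heart\<close>

context triangulated_category
begin

text \<open>Trivial splittings of the vertices make all maps diagonal. Closure under cones only
  concerns the vertices, so the maps stay existential.\<close>

lemma embedded_dist:
  assumes T: "(X, Y, Z, f, g, h) \<in> Dist C"
  obtains f' g' h' where
    "((X, ident C X), (Y, ident C Y), (Z, ident C Z), f', g', h') \<in> Dist (idem_tri_completion C)"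
proof -
  note t = DistD[OF T]
  have diag: "diagonal k (ident C U) 0 (ident C V) 0"
    if "U \<in> Obj C" "V \<in> Obj C" "k \<in> Hom C U V" for U V k
    using that comp_zero_left[of U V V k] comp_zero_right[of U U V k] comp_zero_right[of U V V "ident C V"]
    by (simp add: diagonal_def comp_ident_right ident_hom)
  have dh: "diagonal h (ident C Z) 0 (sh C (ident C X)) (sh C 0)"
    using diag[OF t(3) _ t(6)] t by (simp add: sh_ident)
  show ?thesis
    using dist_idem_completionI[OF T splitting_trivial splitting_trivial splitting_trivial
        diag[OF t(1,2,4)] diag[OF t(2,3,5)] dh] t that by blast
qed

lemma funpow_Sh_Obj: "X \<in> Obj C \<Longrightarrow> (Sh C ^^ n) X \<in> Obj C"
  by (rule funpow_closed) simp_all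

lemma hom_zero_Sh_iff:
  assumes "X \<in> Obj C" "Y \<in> Obj C"
  shows "Hom C (Sh C X) (Sh C Y) = {0} \<longleftrightarrow> Hom C X Y = {0}"
proof
  assume 0: "Hom C (Sh C X) (Sh C Y) = {0}"
  have "f = 0" if "f \<in> Hom C X Y" for f
    using 0 sh_hom[OF assms that] sh_inj[OF assms that zero_hom[OF assms]] by simp
  then show "Hom C X Y = {0}"
    using zero_hom[OF assms] by blast
next
  assume "Hom C X Y = {0}"
  then show "Hom C (Sh C X) (Sh C Y) = {0}"
    using sh_bij[OF assms] by (simp add: bij_betw_def)
qed

lemma hom_zero_funpow_Sh_iff:
  assumes "X \<in> Obj C" "Y \<in> Obj C"
  shows "Hom C ((Sh C ^^ n) X) ((Sh C ^^ n) Y) = {0} \<longleftrightarrow> Hom C X Y = {0}"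
  using assms by (induction n) (simp_all add: hom_zero_Sh_iff funpow_Sh_Obj)

text \<open>This bounds the intersection in \<open>generates\<close> from above.\<close>

lemma strictly_full_triangulated_subcategory_Obj:
  "strictly_full_triangulated_subcategory (idem_tri_completion C) (Obj (idem_tri_completion C))"
  unfolding strictly_full_triangulated_subcategory_def
proof (intro conjI allI impI ballI)
  show "\<exists>Z\<in>Obj (idem_tri_completion C). is_zero (idem_tri_completion C) Z"
  proof -
    obtain Z where "is_zero (idem_completion C) Z"
      using additive_category.ex_zero[OF additive_idem_completion] by blast
    then show ?thesis
      by (intro bexI[of _ Z]) (simp_all add: is_zero_def)
  qed
  show "shift_by (idem_tri_completion C) 1 M \<in> Obj (idem_tri_completion C)"
    "shift_by (idem_tri_completion C) (- 1) M \<in> Obj (idem_tri_completion C)"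
    if "M \<in> Obj (idem_tri_completion C)" for M
    using shift_by_Obj[OF idem_completion_Sh_bij that] by blast+
  show "Z \<in> Obj (idem_tri_completion C)" if "(X, Y, Z, f, g, h) \<in> Dist (idem_tri_completion C)" for X Y Z f g h
  proof -
    have "is_triangle (idem_shift_completion C) (X, Y, Z, f, g, h)"
      using that by (simp add: idem_tri_completion_def triangle_summand_def del: is_triangle.simps)
    then show ?thesis
      by simp
  qed
qed (auto simp: isomorphic_def)

end

lemma Obj_idem_completion_full_subcategory:
  "Obj (idem_completion (full_subcategory C S)) = {(X, p). X \<in> S \<and> p \<in> Hom C X X \<and> p \<cdot>\<^bsub>C\<^esub> p = p}"
  by (auto simp: idem_completion_def)

text \<open>This is the sense in which the completed heart is a full subcategory of the
  completion.\<close>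

lemma idem_completion_full_subcategory:
  assumes "S \<subseteq> Obj C"
  shows "idem_completion (full_subcategory C S) =
    full_subcategory (idem_completion C) (Obj (idem_completion (full_subcategory C S)))"
  by (simp add: idem_completion_def full_subcategory_def)

context bounded_weight_category
begin

text \<open>\<open>w_orth\<close> and \<open>w_geI\<close> describe \<open>w_ge\<close> as a left
  orthogonal; the n-fold shift transports this description.\<close>

lemma funpow_Sh_w_ge_iff:
  assumes "X \<in> Obj C"
  shows "X \<in> (Sh C ^^ n) ` w_ge \<longleftrightarrow> (\<forall>L\<in>w_le. Hom C X ((Sh C ^^ n) (Sh C L)) = {0})"
proof -
  have "X \<in> (Sh C ^^ n) ` Obj C"
    using bij_betw_funpow[OF Sh_bij, of n] assms by (simp add: bij_betw_def)
  then obtain Y where Y: "Y \<in> Obj C" "X = (Sh C ^^ n) Y"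
    by blast
  have "X \<in> (Sh C ^^ n) ` w_ge \<longleftrightarrow> Y \<in> w_ge"
    unfolding Y(2) using bij_betw_imp_inj_on[OF bij_betw_funpow[OF Sh_bij]] Y(1) w_subset_Obj(2)
    by (rule inj_on_image_mem_iff)
  also have "\<dots> \<longleftrightarrow> (\<forall>L\<in>w_le. Hom C Y (Sh C L) = {0})"
  proof
    assume "Y \<in> w_ge"
    then show "\<forall>L\<in>w_le. Hom C Y (Sh C L) = {0}"
      using w_orth zero_hom[OF Y(1) Sh_Obj[OF w_le_Obj]] by blast
  next
    assume "\<forall>L\<in>w_le. Hom C Y (Sh C L) = {0}"
    then show "Y \<in> w_ge"
      using Y(1) by (intro w_geI[OF Y(1)]) blast
  qed
  also have "\<dots> \<longleftrightarrow> (\<forall>L\<in>w_le. Hom C X ((Sh C ^^ n) (Sh C L)) = {0})"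
    unfolding Y(2) using hom_zero_funpow_Sh_iff[OF Y(1) Sh_Obj[OF w_le_Obj]] by (intro ball_cong) auto
  finally show ?thesis .
qed

text \<open>A map from \<open>A\<close> to an object of w_le[n + 1] vanishes on \<open>X\<close>,
  hence factors through \<open>B\<close>. It is 0 there, because w_le[n + 1] is contained in
  w_le[1].\<close>

lemma funpow_Sh_w_ge_extension:
  assumes T: "(X, A, B, f, g, h) \<in> Dist C" and X: "X \<in> (Sh C ^^ n) ` w_ge" and B: "B \<in> w_ge"
  shows "A \<in> (Sh C ^^ n) ` w_ge"
proof -
  note t = DistD[OF T]
  have "d = 0" if L: "L \<in> w_le" and d: "d \<in> Hom C A ((Sh C ^^ n) (Sh C L))" for L d
  proof -
    have L': "(Sh C ^^ n) (Sh C L) \<in> Obj C"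
      using L w_le_Obj funpow_Sh_Obj by simp
    have "d \<cdot> f = 0"
      using X L funpow_Sh_w_ge_iff[OF t(1)] comp_homI[OF d t(4,1,2) L'] by blast
    then obtain c where c: "c \<in> Hom C B ((Sh C ^^ n) (Sh C L))" "c \<cdot> g = d"
      using dist_extend[OF T L' d] by blast
    then have "c = 0"
      using w_orth[OF B w_le_funpow_Sh[OF L, of n]] by (simp add: funpow_swap1)
    then show ?thesis
      using c(2) comp_zero_left[OF t(2,3) L' t(5)] by simp
  qed
  then show ?thesis
    using funpow_Sh_w_ge_iff[OF t(2)] zero_hom[OF t(2) funpow_Sh_Obj[OF Sh_Obj[OF w_le_Obj]]] by blast
qed

section \<open>A triangulated subcategory containing the completed heart is everything\<close>

context
  fixes D
  assumes D: "strictly_full_triangulated_subcategory (idem_tri_completion C) D"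
    and heart_D: "\<And>H e. \<lbrakk>(H, e) \<in> Obj (idem_completion C); H \<in> w_ge; H \<in> w_le\<rbrakk> \<Longrightarrow> (H, e) \<in> D"
begin

lemma D_iso:
  assumes "M \<in> D" "isomorphic (idem_completion C) M N"
  shows "N \<in> D"
proof -
  have "isomorphic (idem_tri_completion C) M N"
    using assms(2) by (simp add: isomorphic_def is_iso_def)
  then show ?thesis
    using D assms(1) unfolding strictly_full_triangulated_subcategory_def by blast
qed

lemma D_Sh: "M \<in> D \<Longrightarrow> Sh (idem_tri_completion C) M \<in> D"
  using D unfolding strictly_full_triangulated_subcategory_def shift_by_one by blast

lemma D_unshift:
  assumes "M \<in> Obj (idem_completion C)" "Sh (idem_tri_completion C) M \<in> D"
  shows "M \<in> D"
proof -
  have "shift_by (idem_tri_completion C) (-1) (Sh (idem_tri_completion C) M) = M"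
    using idem_completion_unshift[of "fst M" "snd M"] assms(1) by (metis idem_tri_completion_simps(5) prod.collapse)
  then show ?thesis
    using D assms(2) unfolding strictly_full_triangulated_subcategory_def by metis
qed

lemma D_dist: "\<lbrakk>(L, M, N, f, g, h) \<in> Dist (idem_tri_completion C); L \<in> D; M \<in> D\<rbrakk> \<Longrightarrow> N \<in> D"
  using D unfolding strictly_full_triangulated_subcategory_def by blast

text \<open>Induction on the width of the weight range. A decomposition of X[-1] rotates to A
  \<rightarrow> B[1] \<rightarrow> X, where \<open>A\<close> has a range shorter by one and B[1]
  lies in the heart, being in \<open>w_le\<close> as an extension of \<open>X\<close> by
  \<open>A\<close>.\<close>

lemma bounded_in_D:
  assumes "X \<in> w_le" "X \<in> (Sh C ^^ n) ` w_ge"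
  shows "(X, ident C X) \<in> D"
  using assms
proof (induction n arbitrary: X)
  case 0
  then show ?case
    using ident_in_idem_completion[OF w_le_Obj] by (intro heart_D) auto
next
  case (Suc n)
  then obtain Y where Y: "Y \<in> w_ge" "X = Sh C ((Sh C ^^ n) Y)"
    by auto
  have Y': "(Sh C ^^ n) Y \<in> Obj C"
    using Y w_ge_Obj funpow_Sh_Obj by blast
  obtain B A f g h where T: "(B, (Sh C ^^ n) Y, A, f, g, h) \<in> Dist C" and B: "Sh C B \<in> w_ge" and A: "A \<in> w_le"
    using w_decomposition[OF Y'] .
  have T1: "((Sh C ^^ n) Y, A, Sh C B, g, h, - sh C f) \<in> Dist C"
    by (rule rotate[OF T])
  have T2: "(A, Sh C B, X, h, - sh C f, - sh C g) \<in> Dist C"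
    unfolding Y(2) by (rule rotate[OF T1])
  have "(A, ident C A) \<in> D"
    using funpow_Sh_w_ge_extension[OF T1 _ B] Y(1) by (intro Suc.IH A) blast
  moreover have "(Sh C B, ident C (Sh C B)) \<in> D"
    using B w_le_extension[OF T2 A Suc.prems(1)] ident_in_idem_completion[OF DistD(2)[OF T2]]
    by (intro heart_D)
  moreover obtain f' g' h' where
    "((A, ident C A), (Sh C B, ident C (Sh C B)), (X, ident C X), f', g', h') \<in> Dist (idem_tri_completion C)"
    using embedded_dist[OF T2] .
  ultimately show ?case
    using D_dist by blast
qed

text \<open>A sufficiently high shift satisfies \<open>bounded_in_D\<close>; the shifts are then
  undone one at a time.\<close>

lemma embedded_in_D:
  assumes X: "X \<in> Obj C"
  shows "(X, ident C X) \<in> D"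
proof -
  obtain k where k: "(Sh C ^^ k) X \<in> w_le"
    using ex_Sh_w_le[OF X] .
  obtain n Y where n: "Y \<in> w_ge" "(Sh C ^^ k) X = (Sh C ^^ n) Y"
    using ex_w_ge_Sh[OF funpow_Sh_Obj[OF X]] .
  have "((Sh C ^^ k) X, ident C ((Sh C ^^ k) X)) \<in> D"
    using n by (intro bounded_in_D[of _ n] k) blast
  then show ?thesis
  proof (induction k)
    case (Suc k)
    let ?M = "((Sh C ^^ k) X, ident C ((Sh C ^^ k) X))"
    have "?M \<in> D"
    proof (rule D_unshift)
      show "?M \<in> Obj (idem_completion C)"
        using ident_in_idem_completion[OF funpow_Sh_Obj[OF X]] .
      show "Sh (idem_tri_completion C) ?M \<in> D"
        using Suc.prems funpow_Sh_Obj[OF X] by (simp add: sh_ident)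
    qed
    then show ?case
      by (rule Suc.IH)
  qed simp
qed

text \<open>After a shift the underlying object lies in \<open>w_ge\<close>. In the rotated triangle
  of \<open>idem_decomposition\<close> the first vertex is then isomorphic to an object of the
  completed heart and the second is an embedded object, so \<open>D\<close> contains the
  third.\<close>

lemma all_in_D:
  assumes M: "(X, p) \<in> Obj (idem_completion C)"
  shows "(X, p) \<in> D"
proof -
  obtain n Y q where Y: "Y \<in> w_ge" "(Y, q) \<in> Obj (idem_completion C)"
    and n: "(X, p) = (Sh (idem_tri_completion C) ^^ n) (Y, q)"
    using idem_ex_w_ge_Sh[OF M] .
  have q: "Y \<in> Obj C" "q \<in> Hom C Y Y" "q \<cdot> q = q"
    using Y(2) by auto
  then obtain B A a f' g' h' where B: "B \<in> Obj C" "Sh C B \<in> w_ge" and A: "A \<in> w_le"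
    and a: "a \<in> Hom C A A" "a \<cdot> a = a"
    and T: "((A, a), (Sh C B, ident C (Sh C B)), (Sh C Y, sh C q), f', g', h') \<in> Dist (idem_tri_completion C)"
    and orth: "\<And>L c. \<lbrakk>Y \<in> w_ge; L \<in> w_le; c \<in> Hom C A (Sh C L)\<rbrakk> \<Longrightarrow> c \<cdot> a = 0"
    by (rule idem_decomposition) blast
  have "(A, a) \<in> w_le'"
    using A a w_le_Obj by (intro summands_self) auto
  then have "(A, a) \<in> summands C (w_ge \<inter> w_le)"
    using orth[OF Y(1)] by (rule summands_heartI)
  then obtain H e where "H \<in> w_ge \<inter> w_le" "(H, e) \<in> Obj (idem_completion C)"
    "isomorphic (idem_completion C) (H, e) (A, a)"
    by (rule summands_isomorphic) (use w_ge_Obj in auto)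
  then have "(A, a) \<in> D"
    using D_iso heart_D by blast
  then have "(Sh C Y, sh C q) \<in> D"
    using D_dist[OF T] embedded_in_D[OF Sh_Obj[OF B(1)]] by blast
  then have "(Y, q) \<in> D"
    using D_unshift[OF Y(2)] by simp
  then show ?thesis
    unfolding n using D_Sh by (intro funpow_closed)
qed

end

lemma heart_generates: "generates (idem_tri_completion C) (Obj (idem_completion (heart C w_le w_ge)))"
proof -
  let ?H = "Obj (idem_completion (heart C w_le w_ge))"
  have H: "?H \<subseteq> Obj (idem_tri_completion C)"
    using w_ge_Obj by (auto simp: heart_def Obj_idem_completion_full_subcategory)
  have "M \<in> D" if "strictly_full_triangulated_subcategory (idem_tri_completion C) D" "?H \<subseteq> D"
    "M \<in> Obj (idem_tri_completion C)" for M D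
  proof -
    have "(Y, e) \<in> D" if "(Y, e) \<in> Obj (idem_completion C)" "Y \<in> w_ge" "Y \<in> w_le" for Y e
      using that \<open>?H \<subseteq> D\<close> by (auto simp: heart_def Obj_idem_completion_full_subcategory)
    then show ?thesis
      using all_in_D[OF that(1), of "fst M" "snd M"] that(3)
      by (simp del: idem_completion_Obj)
  qed
  then show ?thesis
    unfolding generates_def using H strictly_full_triangulated_subcategory_Obj by blast
qed

text \<open>The new heart consists of all summands of old heart objects, the completed heart only of
  idempotents on such objects. By \<open>summands_isomorphic\<close> the inclusion of the latter is
  essentially surjective.\<close>

lemma heart_equivalent:
  "equivalent_categories (heart (idem_tri_completion C) w_le' w_ge') (idem_completion (heart C w_le w_ge))"
proof -
  interpret idem: additive_category "idem_completion C"
    by (rule additive_idem_completion)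
  let ?S = "w_ge \<inter> w_le"
  have S: "?S \<subseteq> Obj C"
    using w_ge_Obj by auto
  let ?H = "Obj (idem_completion (full_subcategory C ?S))"
  have "heart (idem_tri_completion C) w_le' w_ge' = full_subcategory (idem_completion C) (summands C ?S)"
    unfolding heart_def heart_idem_completion by (simp add: full_subcategory_def)
  moreover have "idem_completion (heart C w_le w_ge) = full_subcategory (idem_completion C) ?H"
    unfolding heart_def by (rule idem_completion_full_subcategory[OF S])
  moreover have "equivalent_categories (full_subcategory (idem_completion C) (summands C ?S))
      (full_subcategory (idem_completion C) ?H)"
  proof (rule idem.equivalent_full_subcategory)
    show "?H \<subseteq> summands C ?S"
      using S by (auto simp: Obj_idem_completion_full_subcategory intro!: summands_self)
    show "summands C ?S \<subseteq> Obj (idem_completion C)"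
      by (rule summands_subset_Obj)
    fix M assume "M \<in> summands C ?S"
    then obtain H e where "H \<in> ?S" "(H, e) \<in> Obj (idem_completion C)" "isomorphic (idem_completion C) (H, e) M"
      using S by (rule summands_isomorphic)
    then show "\<exists>N\<in>?H. isomorphic (idem_completion C) N M"
      by (intro bexI[of _ "(H, e)"]) (auto simp: Obj_idem_completion_full_subcategory)
  qed
  ultimately show ?thesis
    by simp
qed

end

theorem proposition5p2p2:
  fixes C :: "('o, 'm::ab_group_add) tri_category"
    and w_le w_ge :: "'o set"
  assumes "triangulated_category C"
    and "bounded_weight_structure C w_le w_ge"
  shows "(\<exists>w_le' w_ge'.
            bounded_weight_structure (idem_tri_completion C) w_le' w_ge' \<and>
            extends_weight_structure C w_le' w_ge' w_le w_ge \<and>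
            equivalent_categories (heart (idem_tri_completion C) w_le' w_ge')
              (idem_completion (heart C w_le w_ge))) \<and>
         generates (idem_tri_completion C) (Obj (idem_completion (heart C w_le w_ge)))"
proof -
  interpret bounded_weight_category C w_le w_ge
    using assms by (simp add: bounded_weight_category_def bounded_weight_category_axioms_def)
  show ?thesis
    using bounded_weight_structure_idem_completion extends_weight_structure_summands
      heart_equivalent heart_generates by blast
qed

end
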